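(* Let $d \in \mathbb{N}$ and let $\mu_d$ be the probability distribution on $\mathbb{R}$ which is the limit in moments, for $n \to \infty$, of the sequence $$s_n = \frac{1}{\sqrt{n}} \Bigl( (\gamma_1 + \cdots + \gamma_n) - \frac{n}{d} \Bigr) \in \mathbb{C}[S_\infty]$$ in the $*$-probability space $(\mathbb{C}[S_\infty], \varphi_d)$; that is, $\int_{\mathbb{R}} t^k \, d\mu_d(t) = \lim_{n\to\infty} \varphi_d(s_n^k)$ for every $k \in \mathbb{N}$. Then $$\mu_d * N(0, 1/d^2) = \nu_d \quad \text{(convolution of probability measures)},$$ where $N(0,1/d^2)$ is the centered normal distribution of variance $1/d^2$ and $\nu_d$ is the average empirical eigenvalue distribution of a $d \times d$ GUE matrix of variance $1$.
   Context: $\mathbb{N} = \{1,2,\ldots\}$. $S_\infty$ is the group of bijections $\tau : \mathbb{N} \to \mathbb{N}$ for which there is $k_o$ with $\tau(k) = k$ for all $k > k_o$. For $\tau \in S_\infty$, $\|\tau\|$ is the minimal number $m$ of transpositions in a factorization $\tau = \rho_1 \cdots \rho_m$ (with $\|\tau\| = 0$ iff $\tau$ is the identity). $\varphi_d : \mathbb{C}[S_\infty] \to \mathbb{C}$ is the linear functional determined by $\varphi_d(\tau) = (1/d)^{\|\tau\|}$ for $\tau \in S_\infty$. The group algebra $\mathbb{C}[S_\infty]$ has the $*$-operation determined by $\tau^* = \tau^{-1}$; $\varphi_d$ is positive, so $(\mathbb{C}[S_\infty],\varphi_d)$ is a $*$-probability space (a unital $*$-algebra over $\mathbb{C}$ with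 a positive linear functional taking the unit to $1$). The star-generators are the transpositions $\gamma_n = (1, n+1)$, $n \in \mathbb{N}$; the scalar $n/d$ in $s_n$ means $n/d$ times the unit. The existence of the limit distribution $\mu_d$ is provided by the central limit theorem for exchangeable sequences. A $d\times d$ GUE matrix of variance $1$ is a random selfadjoint matrix $M$ with diagonal entries $\xi_{i,i}$ ($1 \le i \le d$), $(i,j)$-entry $\xi_{i,j} + \sqrt{-1}\,\eta_{i,j}$ and $(j,i)$-entry $\xi_{i,j} - \sqrt{-1}\,\eta_{i,j}$ for $1 \le i<j \le d$, where all of $\xi_{i,j}$ ($i \le j$) and $\eta_{i,j}$ ($i<j$) are independent centered real Gaussian random variables with $\mathrm{Var}(\xi_{i,i}) = 1/d$ and $\mathrm{Var}(\xi_{i,j}) = \mathrm{Var}(\eta_{i,j}) = 1/(2d)$ for $i<j$. Its average empirical eigenvalue distribution $\nu_d$ is the expectation of the probability measure $\frac{1}{d}\sum_{i=1}^d \delta_{\lambda_i(M)}$, where $\lambda_1(M), \ldots, \lambda_d(M)$ are the eigenvalues of $M$; its moments are $\int t^k d\nu_d(t) = E(\mathrm{tr}_d(M^k))$, where $\mathrm{tr}_d$ is the normalized trace. *)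

theory Defs
  imports
    "HOL-Probability.Probability"
    "HOL-Library.Poly_Mapping"
    "HOL-Combinatorics.Permutations"
    "HOL-Computational_Algebra.Fundamental_Theorem_Algebra"
    "Jordan_Normal_Form.Char_Poly"
begin

section \<open>The infinite symmetric group and its group algebra\<close>

text \<open>
  The underlying set is \<open>\<nat> = {1, 2, \<dots>}\<close>, encoded as \<open>{1..}\<close>; \<open>permutes\<close> makes a
  permutation fix the spare point \<open>0\<close>.
\<close>

typedef sinf = "{\<tau> :: nat \<Rightarrow> nat. \<tau> permutes {1..} \<and> (\<exists>k\<^sub>0. \<forall>k>k\<^sub>0. \<tau> k = k)}"
  morphisms sinf_fun Abs_sinf
  by (rule exI[of _ id]) (auto simp: permutes_id)

setup_lifting type_definition_sinf

text \<open>
  The group law of \<open>S\<^sub>\<infinity>\<close> is composition, but it is written additively (non-commutative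
  \<open>group_add\<close>): the product on \<open>poly_mapping\<close> is the convolution over an additive monoid,
  so that \<open>sinf \<Rightarrow>\<^sub>0 complex\<close> with its library ring structure is the group algebra
  \<open>\<complex>[S\<^sub>\<infinity>]\<close>.
\<close>

instantiation sinf :: group_add
begin

lift_definition zero_sinf :: sinf is id
  by (auto simp: permutes_id)

lift_definition plus_sinf :: "sinf \<Rightarrow> sinf \<Rightarrow> sinf" is "\<lambda>\<sigma> \<tau>. \<sigma> \<circ> \<tau>"
proof (elim CollectE conjE exE, intro CollectI conjI)
  fix \<sigma> \<tau> :: "nat \<Rightarrow> nat" and k l :: nat
  assume "\<sigma> permutes {1..}" "\<tau> permutes {1..}"
  then show "\<sigma> \<circ> \<tau> permutes {1..}"
    by (rule permutes_compose[rotated])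
  assume "\<forall>i>k. \<sigma> i = i" "\<forall>i>l. \<tau> i = i"
  then have "\<forall>i>max k l. (\<sigma> \<circ> \<tau>) i = i"
    by simp
  then show "\<exists>m. \<forall>i>m. (\<sigma> \<circ> \<tau>) i = i" ..
qed

lift_definition uminus_sinf :: "sinf \<Rightarrow> sinf" is "\<lambda>\<tau>. inv_into UNIV \<tau>"
  by (auto intro: permutes_inv simp: permutes_inv_eq) blast

definition minus_sinf :: "sinf \<Rightarrow> sinf \<Rightarrow> sinf" where
  "minus_sinf \<sigma> \<tau> = \<sigma> + (- \<tau>)"

instance
proof
  fix a b c :: sinf
  show "a + b + c = a + (b + c)" by transfer (simp add: o_assoc)
  show "0 + a = a" by transfer simp
  show "a + 0 = a" by transfer simp
  show "- a + a = 0" by transfer (auto simp: permutes_inv_o)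
  show "a + - b = a - b" by (simp add: minus_sinf_def)
qed

end

type_synonym group_algebra = "sinf \<Rightarrow>\<^sub>0 complex"

text \<open>\<open>Transposition.transpose\<close> is qualified because matrix transposition has the same name.\<close>

definition transposition :: "sinf \<Rightarrow> bool" where
  "transposition \<rho> \<longleftrightarrow>
     (\<exists>a\<ge>1. \<exists>b\<ge>1. a \<noteq> b \<and> sinf_fun \<rho> = Transposition.transpose a b)"

text \<open>\<open>sum_list\<close> is the product in \<open>S\<^sub>\<infinity>\<close>, because of the additive notation.\<close>

definition perm_length :: "sinf \<Rightarrow> nat" where
  "perm_length \<tau> =
     (LEAST m. \<exists>\<rho>s. length \<rho>s = m \<and> (\<forall>\<rho>\<in>set \<rho>s. transposition \<rho>) \<and> \<tau> = sum_list \<rho>s)"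

definition phi :: "nat \<Rightarrow> group_algebra \<Rightarrow> complex" where
  "phi d f =
     (\<Sum>\<tau>\<in>Poly_Mapping.keys f. Poly_Mapping.lookup f \<tau> * (1 / of_nat d) ^ perm_length \<tau>)"

text \<open>\<open>scalar c\<close> is \<open>c\<close> times the unit, and \<open>grp \<tau>\<close> is \<open>\<tau>\<close> seen in \<open>\<complex>[S\<^sub>\<infinity>]\<close>.\<close>

definition scalar :: "complex \<Rightarrow> group_algebra" where
  "scalar c = Poly_Mapping.single 0 c"

definition grp :: "sinf \<Rightarrow> group_algebra" where
  "grp \<tau> = Poly_Mapping.single \<tau> 1"

lift_definition star_gen :: "nat \<Rightarrow> sinf" is "\<lambda>n. Transposition.transpose 1 (n + 1)"
proof (intro CollectI conjI)
  fix n :: nat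
  show "Transposition.transpose 1 (n + 1) permutes {1..}"
    by (rule permutes_swap_id) auto
  show "\<exists>k\<^sub>0. \<forall>k>k\<^sub>0. Transposition.transpose 1 (n + 1) k = k"
    by (rule exI[of _ "n + 1"]) (simp add: Transposition.transpose_def)
qed

definition s_seq :: "nat \<Rightarrow> nat \<Rightarrow> group_algebra" where
  "s_seq d n = scalar (of_real (1 / sqrt (real n))) *
     ((\<Sum>i = 1..n. grp (star_gen i)) - scalar (of_nat n / of_nat d))"

text \<open>
  The moments of \<open>\<mu>\<close> are required to exist: without integrability the Bochner integral would
  silently be \<open>0\<close>.
\<close>

definition limit_in_moments :: "('a::monoid_mult \<Rightarrow> complex) \<Rightarrow> (nat \<Rightarrow> 'a) \<Rightarrow> real measure \<Rightarrow> bool" where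
  "limit_in_moments \<phi> a \<mu> \<longleftrightarrow>
     (\<forall>k\<ge>1. integrable \<mu> (\<lambda>t. t ^ k) \<and>
       (\<lambda>n. \<phi> (a n ^ k)) \<longlonglongrightarrow> complex_of_real (\<integral>t. t ^ k \<partial>\<mu>))"


section \<open>GUE matrices\<close>

text \<open>
  Rows and columns are indexed by \<open>0, \<dots>, d - 1\<close>. The second argument of \<open>normal_density\<close>
  is the standard deviation, not the variance. Independence is that of the single family
  consisting of all \<open>\<xi> i j\<close> with \<open>i \<le> j\<close> (left summand) and all \<open>\<eta> i j\<close> with \<open>i < j\<close> (right
  summand).
\<close>

definition GUE_matrix :: "nat \<Rightarrow> 'w measure \<Rightarrow> ('w \<Rightarrow> complex mat) \<Rightarrow> bool" where
  "GUE_matrix d P M \<longleftrightarrow>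
     (\<exists>\<xi> \<eta> :: nat \<Rightarrow> nat \<Rightarrow> 'w \<Rightarrow> real.
        prob_space.indep_vars P (\<lambda>_. borel)
          (case_sum (\<lambda>(i, j). \<xi> i j) (\<lambda>(i, j). \<eta> i j))
          (Inl ` {(i, j). i \<le> j \<and> j < d} \<union> Inr ` {(i, j). i < j \<and> j < d}) \<and>
        (\<forall>i<d. distributed P lborel (\<xi> i i) (normal_density 0 (sqrt (1 / real d)))) \<and>
        (\<forall>i j. i < j \<and> j < d \<longrightarrow>
           distributed P lborel (\<xi> i j) (normal_density 0 (sqrt (1 / (2 * real d)))) \<and>
           distributed P lborel (\<eta> i j) (normal_density 0 (sqrt (1 / (2 * real d))))) \<and>
        (\<forall>\<omega>\<in>space P. M \<omega> = mat d d (\<lambda>(i, j).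
           if i = j then complex_of_real (\<xi> i i \<omega>)
           else if i < j then complex_of_real (\<xi> i j \<omega>) + \<i> * complex_of_real (\<eta> i j \<omega>)
           else complex_of_real (\<xi> j i \<omega>) - \<i> * complex_of_real (\<eta> j i \<omega>))))"

text \<open>
  \<open>(1/d) \<Sum>\<^sub>i \<delta>\<^bsub>\<lambda>\<^sub>i(A)\<^esub>\<close>, the uniform distribution on the multiset of eigenvalues, counted with
  multiplicity as roots of the characteristic polynomial. It is meant for selfadjoint \<open>A\<close>,
  where the eigenvalues are real and \<open>Re\<close> only changes the type.
\<close>

definition empirical_eigenvalue_distr :: "complex mat \<Rightarrow> real measure" where
  "empirical_eigenvalue_distr A =
     distr (measure_pmf (pmf_of_multiset (proots (char_poly A)))) borel Re"

text \<open>
  The expectation of a random measure is the monadic bind of the Giry monad: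
  \<open>B \<mapsto> E(empirical_eigenvalue_distr (M \<omega>) B)\<close>.
\<close>

definition avg_eigenvalue_distr :: "'w measure \<Rightarrow> ('w \<Rightarrow> complex mat) \<Rightarrow> real measure" where
  "avg_eigenvalue_distr P M = P \<bind> (\<lambda>\<omega>. empirical_eigenvalue_distr (M \<omega>))"

end

theory Submission
  imports Defs "Jordan_Normal_Form.Schur_Decomposition"
begin

text \<open>
  By Schur--Weyl duality \<open>phi d\<close> is the normalized trace of the action of permutations on
  \<open>(\<complex>\<^sup>d)\<^bsup>\<otimes>(n+1)\<^esup>\<close>, and the star generator \<open>(1, i + 1)\<close> becomes
  \<open>\<Sum>\<^sub>a\<^sub>b E\<^sub>a\<^sub>b \<otimes> E\<^sub>b\<^sub>a\<close> with the second factor acting on site \<open>i\<close>. Hence \<open>s_seq d n\<close> is a \<open>d \<times> d\<close>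
  matrix whose entries are normalized sums of independent copies of \<open>E\<^sub>b\<^sub>a - \<delta>\<^sub>a\<^sub>b/d\<close>, and the central
  limit theorem replaces them by Gaussians with the covariance of a GUE matrix minus its normalized
  trace. That trace is Gaussian of variance \<open>1/d\<^sup>2\<close> and independent of the traceless part, so
  adding it back is convolution with the normal law. The resulting moments grow slowly enough to
  determine the distribution through its characteristic function.

  Mixed moments are functionals on words of matrix entries. The product \<open>wconv\<close> sums over all
  splittings of a word into two subwords; it is commutative and associative, removing the first
  letter is a derivation for it, and Wick's formula becomes a linear differential equation.
\<close>

section \<open>Convolution of word functionals and Wick functionals\<close>

text \<open>The obstacle is that the matrix entries acting at one site need not commute, so their
  joint moments are not those of a random vector. Words keep the order of the letters; only
  two-letter moments survive the limit, and these are symmetric, so the limit is an ordinary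
  Gaussian family.

  The limit is never constructed separately: every functional satisfying Wick's recursion for the
  two-letter moments of one site is the limit, and the given GUE matrix supplies one through its
  traceless part. The scalar \<open>n / d\<close> supplies the centring, by removing
  \<open>1 / d\<close> from each diagonal entry at each of the \<open>n\<close> sites.

  Only the moments of \<open>\<mu>\<close> are known, so equality of measures needs determinacy.
  Taylor polynomials of characteristic functions are linear in the moments and are averaged over the
  random matrix. The growth bound comes from covariances of modulus at most 1: a word of length
  \<open>k\<close> then has expectation at most the \<open>k\<close>-th absolute bound given by
  standard normal pairings, and an entry of the \<open>k\<close>-th matrix power is a sum over at
  most \<open>d ^ k\<close> paths.\<close>

fun wconv :: "('a list \<Rightarrow> complex) \<Rightarrow> ('a list \<Rightarrow> complex) \<Rightarrow> 'a list \<Rightarrow> complex" where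
  "wconv f g [] = f [] * g []"
| "wconv f g (x # w) = wconv (\<lambda>u. f (x # u)) g w + wconv f (\<lambda>v. g (x # v)) w"

lemma wconv_commute: "wconv f g w = wconv g f w"
  by (induction w arbitrary: f g) (simp_all add: add.commute)

lemma wconv_add_left: "wconv (\<lambda>u. f u + f' u) g w = wconv f g w + wconv f' g w"
  by (induction w arbitrary: f f' g) (simp_all add: algebra_simps)

lemma wconv_scale_left: "wconv (\<lambda>u. c * f u) g w = c * wconv f g w"
  by (induction w arbitrary: f g) (simp_all add: algebra_simps)

lemma wconv_zero_left: "wconv (\<lambda>u. 0) g w = 0"
  using wconv_scale_left[of 0 g g w] by simp

lemma wconv_sum_left: "wconv (\<lambda>u. \<Sum>i\<in>I. f i u) g w = (\<Sum>i\<in>I. wconv (f i) g w)"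
  by (induction I rule: infinite_finite_induct) (simp_all add: wconv_add_left wconv_zero_left)

lemma wconv_add_right: "wconv f (\<lambda>v. g v + g' v) w = wconv f g w + wconv f g' w"
  using wconv_add_left[of g g' f w] by (simp add: wconv_commute[of f])

lemma wconv_scale_right: "wconv f (\<lambda>v. c * g v) w = c * wconv f g w"
  using wconv_scale_left[of c g f w] by (simp add: wconv_commute[of f])

lemma wconv_zero_right: "wconv f (\<lambda>v. 0) w = 0"
  using wconv_zero_left[of f w] by (simp add: wconv_commute[of f])

lemma wconv_sum_right: "wconv f (\<lambda>v. \<Sum>i\<in>I. g i v) w = (\<Sum>i\<in>I. wconv f (g i) w)"
  using wconv_sum_left[of g I f w] by (simp add: wconv_commute[of f])

lemma wconv_assoc: "wconv (wconv f g) h w = wconv f (wconv g h) w"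
  by (induction w arbitrary: f g h)
     (simp_all add: wconv_add_left wconv_add_right algebra_simps)

lemma wconv_left_commute: "wconv f (wconv g h) w = wconv g (wconv f h) w"
proof -
  have "wconv f g = wconv g f" by (rule ext) (rule wconv_commute)
  then show ?thesis by (simp flip: wconv_assoc)
qed

definition wone :: "'a list \<Rightarrow> complex" where
  "wone w = (if w = [] then 1 else 0)"

lemma wconv_wone_left: "wconv wone g w = g w"
  by (induction w arbitrary: g) (simp_all add: wone_def[abs_def] wconv_zero_left)

text \<open>If \<open>t\<close> gives the word moments of one family, \<open>wpow t n\<close> gives
  those of the sum of \<open>n\<close> independent copies: expanding the sum assigns every letter to
  a copy. The unit \<open>wone\<close> is the moment functional of the zero family.\<close>

primrec wpow :: "('a list \<Rightarrow> complex) \<Rightarrow> nat \<Rightarrow> 'a list \<Rightarrow> complex" where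
  "wpow t 0 = wone"
| "wpow t (Suc n) = wconv t (wpow t n)"

lemma wpow_Nil: "wpow t n [] = t [] ^ n"
  by (induction n) (simp_all add: wone_def)

text \<open>The rule for differentiating a power. In terms of copies, the first letter falls into
  one of \<open>n + 1\<close> equivalent copies, which also receives some subword; the other copies
  share the rest.\<close>

lemma wpow_Suc_Cons:
  "wpow t (Suc n) (x # w) = of_nat (Suc n) * wconv (\<lambda>u. t (x # u)) (wpow t n) w"
proof (induction n arbitrary: w)
  case 0
  have "(\<lambda>v. wone (x # v)) = (\<lambda>v. 0)" by (simp add: wone_def)
  then show ?case by (simp add: wconv_zero_right)
next
  case (Suc n)
  have "wpow t (Suc (Suc n)) (x # w) =
      wconv (\<lambda>u. t (x # u)) (wpow t (Suc n)) w + wconv t (\<lambda>v. wpow t (Suc n) (x # v)) w"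
    by simp
  also have "wconv t (\<lambda>v. wpow t (Suc n) (x # v)) w =
      of_nat (Suc n) * wconv (\<lambda>u. t (x # u)) (wpow t (Suc n)) w"
    unfolding Suc.IH wconv_scale_right by (simp add: wconv_left_commute)
  finally show ?case by (simp add: algebra_simps)
qed

lemma tendsto_wconv:
  assumes "w \<in> lists A"
    and "\<And>u. u \<in> lists A \<Longrightarrow> length u \<le> length w \<Longrightarrow> ((\<lambda>n. f n u) \<longlongrightarrow> f' u) F"
    and "\<And>v. v \<in> lists A \<Longrightarrow> length v \<le> length w \<Longrightarrow> ((\<lambda>n. g n v) \<longlongrightarrow> g' v) F"
  shows "((\<lambda>n. wconv (f n) (g n) w) \<longlongrightarrow> wconv f' g' w) F"
  using assms
proof (induction w arbitrary: f f' g g' rule: list.induct)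
  case Nil
  then show ?case by (auto intro!: tendsto_intros)
next
  case (Cons x w)
  have x: "x # u \<in> lists A" if "u \<in> lists A" for u using that Cons.prems(1) by simp
  show ?case
    unfolding wconv.simps
  proof (intro tendsto_add Cons.IH)
    show "w \<in> lists A" "w \<in> lists A" using Cons.prems(1) by auto
  qed (use Cons.prems(2,3) x in simp_all)
qed

lemma wconv_homogeneous:
  "wconv (\<lambda>u. c ^ length u * f u) (\<lambda>v. c ^ length v * g v) w = c ^ length w * wconv f g w"
proof (induction w arbitrary: f g)
  case (Cons x w)
  have "wconv (\<lambda>u. c ^ length (x # u) * f (x # u)) (\<lambda>v. c ^ length v * g v) w =
      c * (c ^ length w * wconv (\<lambda>u. f (x # u)) g w)"
    by (simp add: mult.assoc wconv_scale_left Cons.IH)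
  moreover have "wconv (\<lambda>u. c ^ length u * f u) (\<lambda>v. c ^ length (x # v) * g (x # v)) w =
      c * (c ^ length w * wconv f (\<lambda>v. g (x # v)) w)"
    by (simp add: mult.assoc wconv_scale_right Cons.IH)
  ultimately show ?case by (simp add: algebra_simps)
qed simp

section \<open>The central limit theorem for word functionals\<close>

fun pairing :: "('a \<Rightarrow> 'a \<Rightarrow> complex) \<Rightarrow> 'a \<Rightarrow> 'a list \<Rightarrow> complex" where
  "pairing C x [y] = C x y"
| "pairing C x _ = 0"

text \<open>The recursion pairs the first letter with each possible later partner and so determines
  \<open>W\<close> on \<open>lists A\<close> by length. The alphabet is explicit because the
  covariances of matrix entries are computed only for indices below \<open>d\<close>.\<close>

definition wick_functional :: "'a set \<Rightarrow> ('a \<Rightarrow> 'a \<Rightarrow> complex) \<Rightarrow> ('a list \<Rightarrow> complex) \<Rightarrow> bool" where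
  "wick_functional A C W \<longleftrightarrow> W [] = 1 \<and>
     (\<forall>x\<in>A. \<forall>w\<in>lists A. W (x # w) = wconv (pairing C x) W w)"

text \<open>Induction on the length of the word: peeling off the first letter gives a convolution of
  one copy with \<open>n\<close> copies, and the second factor is covered by the induction
  hypothesis. The peeling relates \<open>n + 1\<close> copies to \<open>n\<close>, so convergence is
  obtained along \<open>Suc n\<close>.\<close>

lemma wpow_tendsto_wick_functional:
  assumes t: "t [] = 1" "\<And>x. x \<in> A \<Longrightarrow> t [x] = 0"
    and W: "wick_functional A (\<lambda>x y. t [x, y]) W"
    and w: "w \<in> lists A"
  shows "(\<lambda>n. of_real (1 / sqrt (real n)) ^ length w * wpow t n w) \<longlonglongrightarrow> W w"
  using w
proof (induction w rule: length_induct)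
  case (1 w)
  show ?case
  proof (cases w)
    case Nil
    then show ?thesis using W by (simp add: wpow_Nil t wick_functional_def)
  next
    case (Cons x w')
    then have x: "x \<in> A" and w': "w' \<in> lists A" using 1(2) by auto
    define c :: "nat \<Rightarrow> complex" where "c n = of_real (1 / sqrt (real n))" for n
    have ratio: "(\<lambda>n. c (Suc n) / c n) \<longlonglongrightarrow> 1"
    proof -
      have "(\<lambda>n. (1 / sqrt (real (Suc n))) / (1 / sqrt (real n))) \<longlonglongrightarrow> 1"
        by real_asymp
      then have "(\<lambda>n. complex_of_real ((1 / sqrt (real (Suc n))) / (1 / sqrt (real n)))) \<longlonglongrightarrow> of_real 1"
        by (intro tendsto_of_real)
      then show ?thesis by (simp add: c_def)
    qed
    \<comment> \<open>The induction hypothesis is scaled by \<open>c n\<close>, the peeled word by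
      \<open>c (Suc n)\<close>. Division by zero makes \<open>c 0 = 0\<close>, so cancelling
      \<open>c n\<close> is done for positive \<open>n\<close>.\<close>
    have R: "(\<lambda>n. c (Suc n) ^ length v * wpow t n v) \<longlonglongrightarrow> W v"
      if "v \<in> lists A" "length v \<le> length w'" for v
    proof -
      have "(\<lambda>n. c n ^ length v * wpow t n v) \<longlonglongrightarrow> W v"
        unfolding c_def using 1(1) that Cons by auto
      then have "(\<lambda>n. (c (Suc n) / c n) ^ length v * (c n ^ length v * wpow t n v)) \<longlonglongrightarrow> 1 ^ length v * W v"
        by (intro tendsto_mult tendsto_power ratio)
      moreover have "\<forall>\<^sub>F n in sequentially.
          (c (Suc n) / c n) ^ length v * (c n ^ length v * wpow t n v) = c (Suc n) ^ length v * wpow t n v"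
        using eventually_gt_at_top[of 0]
        by eventually_elim (simp add: c_def power_divide)
      ultimately show ?thesis by (simp add: tendsto_cong)
    qed
    have csq: "of_nat (Suc n) * c (Suc n) ^ 2 = 1" for n
    proof -
      have "real (Suc n) * (1 / sqrt (real (Suc n)))\<^sup>2 = 1"
        by (simp add: power_divide)
      then have "complex_of_real (real (Suc n) * (1 / sqrt (real (Suc n)))\<^sup>2) = 1" by simp
      then show ?thesis by (simp only: c_def of_real_mult of_real_power of_real_of_nat_eq)
    qed
    have c0: "(\<lambda>n. c (Suc n)) \<longlonglongrightarrow> 0"
    proof -
      have "(\<lambda>n. 1 / sqrt (real (Suc n))) \<longlonglongrightarrow> 0" by real_asymp
      from tendsto_of_real[OF this] show ?thesis
        unfolding c_def by (simp only: of_real_0)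
    qed
    \<comment> \<open>The counting of orders: an empty \<open>u\<close> is killed by centring, one
      letter gives \<open>(n + 1) * c (Suc n) ^ 2 = 1\<close> times the covariance, and every
      further letter leaves a factor \<open>c (Suc n)\<close>, which tends to 0.\<close>
    have L: "(\<lambda>n. of_nat (Suc n) * c (Suc n) * (c (Suc n) ^ length u * t (x # u))) \<longlonglongrightarrow>
        pairing (\<lambda>x y. t [x, y]) x u" for u
    proof (cases u)
      case Nil
      then show ?thesis by (simp add: t x)
    next
      case (Cons y u')
      have "of_nat (Suc n) * c (Suc n) * (c (Suc n) ^ length u * t (x # u)) =
          c (Suc n) ^ length u' * t (x # u)" for n
      proof -
        have "of_nat (Suc n) * c (Suc n) * (c (Suc n) ^ length u * t (x # u)) =
            (of_nat (Suc n) * c (Suc n) ^ 2) * (c (Suc n) ^ length u' * t (x # u))"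
          unfolding Cons list.size power2_eq_square by (simp only: power_Suc add_0_right add_Suc_right mult_ac)
        then show ?thesis by (simp only: csq mult_1_left)
      qed
      moreover have "(\<lambda>n. c (Suc n) ^ length u' * t (x # u)) \<longlonglongrightarrow> pairing (\<lambda>x y. t [x, y]) x u"
      proof (cases u')
        case Nil
        then show ?thesis by (simp add: Cons)
      next
        case (Cons z u'')
        have "(\<lambda>n. c (Suc n) ^ length u' * t (x # u)) \<longlonglongrightarrow> 0 ^ length u' * t (x # u)"
          by (intro tendsto_intros c0)
        then show ?thesis by (simp add: \<open>u = y # u'\<close> Cons)
      qed
      ultimately show ?thesis by (simp only:)
    qed
    have "(\<lambda>n. wconv (\<lambda>u. of_nat (Suc n) * c (Suc n) * (c (Suc n) ^ length u * t (x # u)))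
             (\<lambda>v. c (Suc n) ^ length v * wpow t n v) w') \<longlonglongrightarrow>
          wconv (pairing (\<lambda>x y. t [x, y]) x) W w'"
      by (rule tendsto_wconv[OF w']) (use L R in auto)
    also have "wconv (pairing (\<lambda>x y. t [x, y]) x) W w' = W w"
      using W x w' by (simp add: wick_functional_def Cons)
    also have "(\<lambda>n. wconv (\<lambda>u. of_nat (Suc n) * c (Suc n) * (c (Suc n) ^ length u * t (x # u)))
             (\<lambda>v. c (Suc n) ^ length v * wpow t n v) w') = (\<lambda>n. c (Suc n) ^ length w * wpow t (Suc n) w)"
      by (simp only: wconv_scale_left wconv_homogeneous Cons wpow_Suc_Cons list.size
          power_Suc add_0_right add_Suc_right) (simp only: mult_ac)
    finally show ?thesis
      unfolding c_def[symmetric] by (rule LIMSEQ_imp_Suc)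
  qed
qed

section \<open>Sums of local operators on tensor powers\<close>

text \<open>Acting on functions of the colour of one site, \<open>site d (a, b)\<close> is \<open>E\<^sub>b\<^sub>a - \<delta>\<^sub>a\<^sub>b/d\<close>.\<close>

fun site :: "nat \<Rightarrow> nat \<times> nat \<Rightarrow> (nat \<Rightarrow> complex) \<Rightarrow> nat \<Rightarrow> complex" where
  "site d (a, b) \<theta> c = (if c = b then \<theta> a else 0) - (if a = b then \<theta> c / of_nat d else 0)"

fun site_sum :: "nat \<Rightarrow> nat \<times> nat \<Rightarrow> (nat list \<Rightarrow> complex) \<Rightarrow> nat list \<Rightarrow> complex" where
  "site_sum d (a, b) \<psi> h = (\<Sum>i<length h.
     (if h ! i = b then \<psi> (h[i := a]) else 0) - (if a = b then \<psi> h / of_nat d else 0))"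

lemma site_sum_Nil: "site_sum d x \<psi> [] = 0"
  by (cases x) simp

lemma site_sum_Cons:
  "site_sum d x \<psi> (c # h) = site d x (\<lambda>c'. \<psi> (c' # h)) c + site_sum d x (\<lambda>h'. \<psi> (c # h')) h"
proof (cases x)
  case (Pair a b)
  show ?thesis
    unfolding Pair site_sum.simps length_Cons sum.lessThan_Suc_shift by (simp cong: if_cong)
qed

lemma site_wconv_left: "site d x (\<lambda>c'. wconv (F c') g w) c = wconv (\<lambda>u. site d x (\<lambda>c'. F c' u) c) g w"
proof (cases x)
  case (Pair a b)
  have "wconv (\<lambda>u. site d (a, b) (\<lambda>c'. F c' u) c) g w =
     wconv (\<lambda>u. (if c = b then 1 else 0) * F a u + (- (if a = b then 1 / of_nat d else 0)) * F c u) g w"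
    by (rule arg_cong[where f = "\<lambda>f. wconv f g w"]) auto
  also have "\<dots> = site d (a, b) (\<lambda>c'. wconv (F c') g w) c"
    unfolding wconv_add_left wconv_scale_left by simp
  finally show ?thesis by (simp add: Pair)
qed

lemma site_sum_add: "site_sum d x (\<lambda>h. \<psi> h + \<psi>' h) h = site_sum d x \<psi> h + site_sum d x \<psi>' h"
proof (cases x)
  case (Pair a b)
  show ?thesis
    unfolding Pair site_sum.simps sum.distrib[symmetric]
    by (rule sum.cong) (auto simp: add_divide_distrib)
qed

lemma site_sum_scale: "site_sum d x (\<lambda>h. c * \<psi> h) h = c * site_sum d x \<psi> h"
proof (cases x)
  case (Pair a b)
  show ?thesis
    unfolding Pair site_sum.simps sum_distrib_left
    by (rule sum.cong) (auto simp: right_diff_distrib)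
qed

lemma site_sum_sum: "site_sum d x (\<lambda>h. \<Sum>i\<in>I. \<psi> i h) h = (\<Sum>i\<in>I. site_sum d x (\<psi> i) h)"
proof (induction I rule: infinite_finite_induct)
  case (insert i I)
  then show ?case by (simp add: site_sum_add)
qed (use site_sum_scale[of d x 0 "\<lambda>h. 0" h] in simp_all)

lemma site_sum_wconv_right:
  "site_sum d x (\<lambda>h'. wconv f (G h') w) h = wconv f (\<lambda>v. site_sum d x (\<lambda>h'. G h' v) h) w"
  by (induction w arbitrary: f G) (simp_all add: site_sum_scale site_sum_add)

text \<open>Recolouring a site with \<open>a < d\<close> stays among the lists with colours below
  \<open>d\<close>. The formula for powers of \<open>s_seq\<close> is only available on those
  lists.\<close>

lemma site_sum_cong:
  assumes "a < d" "length h = n" "set h \<subseteq> {..<d}"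
    and "\<And>h'. length h' = n \<Longrightarrow> set h' \<subseteq> {..<d} \<Longrightarrow> \<psi> h' = \<psi>' h'"
  shows "site_sum d (a, b) \<psi> h = site_sum d (a, b) \<psi>' h"
proof -
  have "\<psi> (h[i := a]) = \<psi>' (h[i := a])" for i
    using assms set_update_subset_insert[of h i a] by (intro assms(4)) auto
  moreover have "\<psi> h = \<psi>' h" using assms by simp
  ultimately show ?thesis by (simp cong: if_cong)
qed

lemma foldr_site_sum_cong:
  assumes "\<And>h'. length h' = length h \<Longrightarrow> \<psi> h' = \<psi>' h'"
  shows "foldr (site_sum d) w \<psi> h = foldr (site_sum d) w \<psi>' h"
  using assms
proof (induction w arbitrary: h)
  case (Cons x w)
  have "foldr (site_sum d) w \<psi> h' = foldr (site_sum d) w \<psi>' h'" if "length h' = length h" for h'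
    using that Cons.prems by (intro Cons.IH) simp
  then show ?case by (cases x) (simp cong: if_cong)
qed simp

lemma foldr_site_sum_zero: "foldr (site_sum d) w (\<lambda>h. 0) h = 0"
proof (induction w arbitrary: h)
  case (Cons x w)
  then show ?case by (cases x) (simp cong: if_cong)
qed simp

text \<open>On a product vector each letter acts either on the first site or on the remaining ones.
  Operators on different sites commute, so only the order inside the two subwords matters, which is
  what \<open>wconv\<close> records.\<close>

lemma foldr_site_sum_tensor:
  assumes "\<And>c h. \<psi> (c # h) = \<theta> c * \<eta> h"
  shows "foldr (site_sum d) w \<psi> (c # h) =
    wconv (\<lambda>u. foldr (site d) u \<theta> c) (\<lambda>v. foldr (site_sum d) v \<eta> h) w"
proof (induction w arbitrary: c h)
  case (Cons x w)
  have "foldr (site_sum d) (x # w) \<psi> (c # h) =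
      site d x (\<lambda>c'. foldr (site_sum d) w \<psi> (c' # h)) c +
      site_sum d x (\<lambda>h'. foldr (site_sum d) w \<psi> (c # h')) h"
    by (simp add: site_sum_Cons)
  then show ?case
    by (simp add: Cons.IH site_wconv_left site_sum_wconv_right)
qed (simp add: assms)

section \<open>Normalized traces on tensor powers\<close>

definition configs :: "nat \<Rightarrow> nat \<Rightarrow> nat list set" where
  "configs d n = {h. length h = n \<and> set h \<subseteq> {..<d}}"

text \<open>A diagonal entry is read off by applying the operator to the indicator of
  \<open>h\<close> and evaluating at \<open>h\<close>. The \<open>n\<close> sites do not include the
  distinguished point 1, whose colour becomes the matrix index.\<close>

definition config_trace :: "nat \<Rightarrow> nat \<Rightarrow> (nat \<times> nat) list \<Rightarrow> complex" where
  "config_trace d n w = (1 / of_nat d) ^ n *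
     (\<Sum>h\<in>configs d n. foldr (site_sum d) w (\<lambda>h'. if h' = h then 1 else 0) h)"

definition site_trace :: "nat \<Rightarrow> (nat \<times> nat) list \<Rightarrow> complex" where
  "site_trace d w = (1 / of_nat d) * (\<Sum>c<d. foldr (site d) w (\<lambda>c'. if c' = c then 1 else 0) c)"

lemma finite_configs [simp]: "finite (configs d n)"
  using finite_lists_length_eq[of "{..<d}" n] by (simp add: configs_def conj_commute)

lemma configs_0: "configs d 0 = {[]}"
  by (auto simp: configs_def)

lemma sum_configs_Suc: "(\<Sum>h\<in>configs d (Suc n). f h) = (\<Sum>c<d. \<Sum>h\<in>configs d n. f (c # h))"
proof -
  have "configs d (Suc n) = (\<lambda>(c, h). c # h) ` ({..<d} \<times> configs d n)"
    by (auto simp: configs_def length_Suc_conv image_iff)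
  moreover have "inj_on (\<lambda>(c, h). c # h) ({..<d} \<times> configs d n)"
    by (auto simp: inj_on_def)
  ultimately show ?thesis
    by (simp add: sum.reindex sum.cartesian_product case_prod_unfold)
qed

text \<open>The normalized trace is multiplicative on tensor products, so the \<open>n\<close> sites
  behave as independent copies. Without sites every letter acts as zero, which gives
  \<open>wone\<close>.\<close>

lemma config_trace_eq_wpow: "config_trace d n = wpow (site_trace d) n"
proof (induction n)
  case 0
  have "config_trace d 0 w = wone w" for w
    by (cases w) (simp_all add: config_trace_def configs_0 wone_def site_sum_Nil)
  then show ?case by auto
next
  case (Suc n)
  have "config_trace d (Suc n) w = wpow (site_trace d) (Suc n) w" for w
  proof -
    let ?\<delta> = "\<lambda>h h'. if h' = h then 1 else 0 :: complex"
    have "config_trace d (Suc n) w = (1 / of_nat d) ^ Suc n *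
        (\<Sum>c<d. \<Sum>h\<in>configs d n. foldr (site_sum d) w (?\<delta> (c # h)) (c # h))"
      by (simp add: config_trace_def sum_configs_Suc)
    also have "\<dots> = (1 / of_nat d) ^ Suc n * (\<Sum>c<d. \<Sum>h\<in>configs d n.
        wconv (\<lambda>u. foldr (site d) u (\<lambda>c'. if c' = c then 1 else 0) c)
          (\<lambda>v. foldr (site_sum d) v (?\<delta> h) h) w)"
      by (intro arg_cong[where f = "\<lambda>s. (1 / of_nat d) ^ Suc n * s"] sum.cong refl
          foldr_site_sum_tensor) simp
    also have "\<dots> = wconv (site_trace d) (config_trace d n) w"
      unfolding site_trace_def[abs_def] config_trace_def[abs_def]
      by (simp only: wconv_scale_left wconv_scale_right wconv_sum_left wconv_sum_right power_Suc mult.assoc)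
    finally show ?thesis by (simp add: Suc.IH)
  qed
  then show ?case by blast
qed

lemma site_trace_Nil: "d \<ge> 1 \<Longrightarrow> site_trace d [] = 1"
  by (simp add: site_trace_def)

text \<open>The trace of a matrix unit is 1 or 0, and the subtracted \<open>1 / d\<close> on the
  diagonal occurs once for each of the \<open>d\<close> colours. This is the centring that the limit
  theorem asks for.\<close>

lemma site_trace_single:
  assumes "a < d" "b < d"
  shows "site_trace d [(a, b)] = 0"
proof -
  have "(\<Sum>c<d. site d (a, b) (\<lambda>c'. if c' = c then 1 else 0) c) =
      (\<Sum>c<d. if c = b then (if a = b then 1 else 0) else 0) - (\<Sum>c<d. if a = b then 1 / of_nat d else 0)"
    unfolding sum_subtractf[symmetric] by (rule sum.cong) auto
  also have "\<dots> = 0" using assms by (auto simp: sum.delta)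
  finally show ?thesis by (simp add: site_trace_def)
qed

text \<open>The covariance of the entries of a GUE matrix minus its normalized trace:
  \<open>1 / d\<close> for two mutually transposed positions, less the variance
  \<open>1 / d^2\<close> of the trace for two diagonal positions.\<close>

definition traceless_cov :: "nat \<Rightarrow> nat \<times> nat \<Rightarrow> nat \<times> nat \<Rightarrow> complex" where
  "traceless_cov d x y = (if fst x = snd y \<and> snd x = fst y then 1 / of_nat d else 0) -
     (if fst x = snd x \<and> fst y = snd y then 1 / (of_nat d)\<^sup>2 else 0)"

lemma site_trace_pair:
  assumes "a < d" "b < d" "e < d" "f < d"
  shows "site_trace d [(a, b), (e, f)] = traceless_cov d (a, b) (e, f)"
proof -
  have d: "complex_of_nat d \<noteq> 0" using assms by auto
  have "(\<Sum>c<d. site d (a, b) (site d (e, f) (\<lambda>c'. if c' = c then 1 else 0)) c) =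
     (\<Sum>c<d. if c = b then (if a = f \<and> e = b then 1 else 0) else 0)
     - (\<Sum>c<d. if c = b then (if e = f \<and> a = b then 1 / of_nat d else 0) else 0)
     - (\<Sum>c<d. if c = f then (if a = b \<and> e = f then 1 / of_nat d else 0) else 0)
     + (\<Sum>c<d. if a = b \<and> e = f then 1 / of_nat d / of_nat d else 0)"
    unfolding sum_subtractf[symmetric] sum.distrib[symmetric]
    using d by (intro sum.cong refl) (auto simp: field_simps)
  also have "\<dots> = (if a = f \<and> e = b then 1 else 0) - (if a = b \<and> e = f then 1 / of_nat d else 0)"
    using assms d by (auto simp: sum.delta)
  finally have "site_trace d [(a, b), (e, f)] = 1 / of_nat d *
      ((if a = f \<and> b = e then 1 else 0) - (if a = b \<and> e = f then 1 / of_nat d else 0))"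
    unfolding site_trace_def by (simp add: eq_commute[of e b])
  then show ?thesis
    unfolding traceless_cov_def fst_conv snd_conv
    by (cases "a = f \<and> b = e"; cases "a = b \<and> e = f")
       (simp_all only: power2_eq_square if_True if_False simp_thms diff_zero right_diff_distrib
         mult_1_right mult_zero_right times_divide_times_eq)
qed

text \<open>The expansion of an entry of a \<open>k\<close>-th matrix power over index paths. The
  word of entries is kept instead of their product, so that the same expansion serves for operators,
  for numbers and for values of a moment functional.\<close>

primrec path_sum :: "nat \<Rightarrow> nat \<Rightarrow> nat \<Rightarrow> nat \<Rightarrow> ((nat \<times> nat) list \<Rightarrow> 'a::comm_monoid_add) \<Rightarrow> 'a" where
  "path_sum d 0 a b F = (if a = b then F [] else 0)"
| "path_sum d (Suc k) a b F = (\<Sum>c<d. path_sum d k c b (\<lambda>w. F ((a, c) # w)))"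

lemma path_sum_cong:
  assumes "a < d" "b < d"
    and "\<And>w. length w = k \<Longrightarrow> w \<in> lists ({..<d} \<times> {..<d}) \<Longrightarrow> F w = G w"
  shows "path_sum d k a b F = path_sum d k a b G"
  using assms
proof (induction k arbitrary: a F G)
  case (Suc k)
  show ?case
    unfolding path_sum.simps
    by (intro sum.cong refl Suc.IH Suc.prems(3)) (use Suc.prems in auto)
qed simp

lemma path_sum_sum: "path_sum d k a b (\<lambda>w. \<Sum>i\<in>I. F i w) = (\<Sum>i\<in>I. path_sum d k a b (F i))"
proof (induction k arbitrary: a F)
  case (Suc k)
  have "path_sum d (Suc k) a b (\<lambda>w. \<Sum>i\<in>I. F i w) =
      (\<Sum>c<d. \<Sum>i\<in>I. path_sum d k c b (\<lambda>w. F i ((a, c) # w)))"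
    by (simp add: Suc.IH)
  then show ?case by (subst (asm) sum.swap) simp
qed simp

lemma path_sum_scale:
  fixes F :: "(nat \<times> nat) list \<Rightarrow> 'a::comm_semiring_0"
  shows "path_sum d k a b (\<lambda>w. r * F w) = r * path_sum d k a b F"
  by (induction k arbitrary: a F) (simp_all add: sum_distrib_left)

lemma site_sum_path_sum:
  "site_sum d x (\<lambda>h. path_sum d k a b (\<lambda>w. F w h)) h = path_sum d k a b (\<lambda>w. site_sum d x (F w) h)"
proof (induction k arbitrary: a F)
  case 0
  then show ?case using site_sum_scale[of d x 0 "\<lambda>h. 0" h] by simp
qed (simp add: site_sum_sum)

lemma tendsto_path_sum:
  fixes F :: "'i \<Rightarrow> (nat \<times> nat) list \<Rightarrow> complex"
  assumes "a < d" "b < d"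
    and "\<And>w. length w = k \<Longrightarrow> w \<in> lists ({..<d} \<times> {..<d}) \<Longrightarrow> ((\<lambda>n. F n w) \<longlongrightarrow> G w) X"
  shows "((\<lambda>n. path_sum d k a b (F n)) \<longlongrightarrow> path_sum d k a b G) X"
  using assms
proof (induction k arbitrary: a F G)
  case (Suc k)
  show ?case
    unfolding path_sum.simps
    by (intro tendsto_sum Suc.IH Suc.prems(3)) (use Suc.prems in auto)
qed auto

section \<open>Schur-Weyl representation of the infinite symmetric group\<close>

lemma sinf_fun_add: "sinf_fun (\<sigma> + \<tau>) = sinf_fun \<sigma> \<circ> sinf_fun \<tau>"
  by (rule plus_sinf.rep_eq)

lemma sinf_fun_permutes: "sinf_fun \<tau> permutes {1..}"
  using sinf_fun[of \<tau>] by simp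

lemma inj_sinf_fun: "inj (sinf_fun \<tau>)"
  using sinf_fun_permutes[of \<tau>] by (simp add: permutes_inj)

lemma sinf_fun_0_point: "sinf_fun \<tau> 0 = 0"
  using permutes_not_in[OF sinf_fun_permutes[of \<tau>], of 0] by simp

lemma sinf_fun_ge_1: "1 \<le> p \<Longrightarrow> 1 \<le> sinf_fun \<tau> p"
  using permutes_in_image[OF sinf_fun_permutes[of \<tau>], of p] by simp

definition swap :: "nat \<Rightarrow> nat \<Rightarrow> sinf" where
  "swap a b = Abs_sinf (Transposition.transpose a b)"

lemma sinf_fun_swap:
  assumes "1 \<le> a" "1 \<le> b"
  shows "sinf_fun (swap a b) = Transposition.transpose a b"
proof -
  have "Transposition.transpose a b permutes {1..}"
    using assms by (intro permutes_swap_id) auto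
  moreover have "\<forall>k>max a b. Transposition.transpose a b k = k"
    by (auto simp: Transposition.transpose_def)
  ultimately show ?thesis
    unfolding swap_def by (intro Abs_sinf_inverse) blast
qed

lemma transposition_swap: "1 \<le> a \<Longrightarrow> 1 \<le> b \<Longrightarrow> a \<noteq> b \<Longrightarrow> transposition (swap a b)"
  unfolding transposition_def using sinf_fun_swap by blast

definition supported :: "nat \<Rightarrow> sinf set" where
  "supported N = {\<tau>. \<forall>k>N. sinf_fun \<tau> k = k}"

lemma supported_le:
  assumes "\<tau> \<in> supported N" "p \<le> N"
  shows "sinf_fun \<tau> p \<le> N"
proof (rule ccontr)
  assume "\<not> sinf_fun \<tau> p \<le> N"
  then have "sinf_fun \<tau> (sinf_fun \<tau> p) = sinf_fun \<tau> p"
    using assms by (simp add: supported_def)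
  then have "sinf_fun \<tau> p = p" using inj_sinf_fun by (metis injD)
  then show False using assms \<open>\<not> sinf_fun \<tau> p \<le> N\<close> by simp
qed

lemma supported_add: "\<sigma> \<in> supported N \<Longrightarrow> \<tau> \<in> supported N \<Longrightarrow> \<sigma> + \<tau> \<in> supported N"
  by (simp add: supported_def sinf_fun_add)

section \<open>Counting the colourings invariant under a permutation\<close>

definition colourings :: "nat \<Rightarrow> nat \<Rightarrow> (nat \<Rightarrow> nat) set" where
  "colourings d N = PiE_dflt {1..N} 0 (\<lambda>_. {..<d})"

lemma finite_colourings [simp]: "finite (colourings d N)"
  by (simp add: colourings_def finite_PiE_dflt)

lemma card_colourings: "card (colourings d N) = d ^ N"
  by (simp add: colourings_def card_PiE_dflt)

lemma colourings_lt: "d \<ge> 1 \<Longrightarrow> f \<in> colourings d N \<Longrightarrow> f p < d"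
  by (cases "p \<in> {1..N}") (auto simp: colourings_def PiE_dflt_def)

lemma comp_transpose_eq_iff: "f \<circ> Transposition.transpose a b = f \<longleftrightarrow> f a = f b"
  by (auto simp: fun_eq_iff Transposition.transpose_def)

definition invariant_colourings :: "nat \<Rightarrow> nat \<Rightarrow> sinf \<Rightarrow> (nat \<Rightarrow> nat) set" where
  "invariant_colourings d N \<tau> = {f \<in> colourings d N. f \<circ> sinf_fun \<tau> = f}"

text \<open>Reading colours modulo \<open>d\<close>, each equation \<open>f a = f b\<close> cuts out the kernel of a homomorphism
  into \<open>\<int>/d\<close>, hence a subset of index at most \<open>d\<close>.\<close>

lemma card_equalizer_ge:
  assumes d: "d \<ge> 1"
  shows "d ^ N \<le> card {f \<in> colourings d N. \<forall>(a, b) \<in> set ps. f a = f b} * d ^ length ps"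
proof (induction ps)
  case Nil
  then show ?case by (simp add: card_colourings)
next
  case (Cons p ps)
  obtain a b where p: "p = (a, b)" by (cases p)
  define S where "S = {f \<in> colourings d N. \<forall>(a, b) \<in> set ps. f a = f b}"
  define K where "K = {f \<in> colourings d N. \<forall>(a, b) \<in> set (p # ps). f a = f b}"
  define v where "v f = (f a + (d - f b)) mod d" for f :: "nat \<Rightarrow> nat"
  have fin: "finite S" "finite K" by (simp_all add: S_def K_def)
  have fibre: "card {f \<in> S. v f = r} \<le> card K" for r
  proof (cases "\<exists>g\<in>S. v g = r")
    case True
    then obtain g where g: "g \<in> S" "v g = r" by blast
    \<comment> \<open>Translation by a fixed element \<open>g\<close> of the fibre moves the fibre
      injectively into \<open>K\<close>. Subtraction modulo \<open>d\<close> is written with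
      \<open>d - g q\<close>, which does not truncate because \<open>g q < d\<close>; outside
      \<open>{1..N}\<close> it sends the default colour 0 to \<open>d mod d = 0\<close>.\<close>
    define sub where "sub f = (\<lambda>q. (f q + (d - g q)) mod d)" for f :: "nat \<Rightarrow> nat"
    have lt: "f q < d" if "f \<in> S" for f q
      using that d by (auto simp: S_def intro: colourings_lt)
    have cong: "x = y" if "(x + z) mod d = (y + z) mod d" "x < d" "y < d" for x y z :: nat
    proof -
      from that(1) have "int ((x + z) mod d) = int ((y + z) mod d)" by simp
      then have "int x mod int d = int y mod int d" by (simp add: zmod_int mod_eq_dvd_iff)
      then have "x mod d = y mod d" by (simp flip: zmod_int)
      then show ?thesis using that by simp
    qed
    have "inj_on sub S"
    proof (rule inj_onI, rule ext)
      fix f f' q assume "f \<in> S" "f' \<in> S" "sub f = sub f'"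
      then show "f q = f' q"
        using cong[of "f q" "d - g q" "f' q"] lt by (auto simp: sub_def fun_eq_iff)
    qed
    moreover have "sub ` {f \<in> S. v f = r} \<subseteq> K"
    proof (intro image_subsetI)
      fix f assume "f \<in> {f \<in> S. v f = r}"
      then have f: "f \<in> S" "v f = v g" using g by auto
      have "sub f \<in> colourings d N"
        using f(1) g(1) d by (auto simp: sub_def S_def colourings_def PiE_dflt_def)
      moreover have "sub f a' = sub f b'" if "(a', b') \<in> set ps" for a' b'
      proof -
        have "f a' = f b'" "g a' = g b'" using f(1) g(1) that by (auto simp: S_def)
        then show ?thesis by (simp add: sub_def)
      qed
      moreover have "sub f a = sub f b"
      proof -
        have "(int (f a) - int (f b)) mod int d = (int (g a) - int (g b)) mod int d"
        proof -
          have *: "int (v h) = (int (h a) - int (h b)) mod int d" if "h \<in> S" for h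
          proof -
            have "int (v h) = (int (h a) - int (h b) + int d) mod int d"
              using lt[OF that, of b] by (simp add: v_def zmod_int of_nat_diff algebra_simps)
            then show ?thesis by simp
          qed
          show ?thesis using *[OF f(1)] *[OF g(1)] f(2) by simp
        qed
        then have "int d dvd (int (f a) - int (f b)) - (int (g a) - int (g b))"
          by (simp add: mod_eq_dvd_iff)
        then have "int d dvd (int (f a) + (int d - int (g a))) - (int (f b) + (int d - int (g b)))"
          by (simp add: algebra_simps)
        then have "(int (f a) + (int d - int (g a))) mod int d = (int (f b) + (int d - int (g b))) mod int d"
          by (subst mod_eq_dvd_iff)
        then have "int (sub f a) = int (sub f b)"
          using lt[OF g(1), of a] lt[OF g(1), of b]
          by (simp add: sub_def zmod_int of_nat_diff add_diff_eq)
        then show ?thesis by simp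
      qed
      ultimately show "sub f \<in> K" by (auto simp: K_def p)
    qed
    ultimately show ?thesis
      by (intro card_inj_on_le[of sub] fin) (auto intro: inj_on_subset)
  next
    case False
    then have "{f \<in> S. v f = r} = {}" by auto
    then show ?thesis by (metis card.empty le0)
  qed
  have "S = (\<Union>r<d. {f \<in> S. v f = r})" using d by (auto simp: v_def)
  then have "card S \<le> (\<Sum>r<d. card {f \<in> S. v f = r})"
    using card_UN_le[of "{..<d}" "\<lambda>r. {f \<in> S. v f = r}"] by simp
  also have "\<dots> \<le> (\<Sum>r<d. card K)" by (intro sum_mono fibre)
  finally have "card S \<le> d * card K" by simp
  have "d ^ N \<le> card S * d ^ length ps" using Cons.IH by (simp only: S_def)
  also have "\<dots> \<le> d * card K * d ^ length ps"
    using \<open>card S \<le> d * card K\<close> by (rule mult_le_mono1)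
  finally have "d ^ N \<le> card K * d ^ length (p # ps)" by (simp add: mult_ac)
  then show ?case by (simp only: K_def)
qed

text \<open>Each transposition of a factorization asks for one equality of two colours, and a
  colouring that satisfies all of them is invariant under the product. Applied to a shortest
  factorization this bounds the count from below.\<close>

lemma card_invariant_ge:
  assumes d: "d \<ge> 1" and \<rho>s: "\<forall>\<rho>\<in>set \<rho>s. transposition \<rho>"
  shows "d ^ N \<le> card (invariant_colourings d N (sum_list \<rho>s)) * d ^ length \<rho>s"
proof -
  obtain ps where ps: "length ps = length \<rho>s"
    "\<And>f :: nat \<Rightarrow> nat. (\<forall>(a, b) \<in> set ps. f a = f b) \<Longrightarrow> f \<circ> sinf_fun (sum_list \<rho>s) = f"
  proof -
    have "\<exists>ps. length ps = length \<rho>s \<and>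
      (\<forall>f :: nat \<Rightarrow> nat. (\<forall>(a, b) \<in> set ps. f a = f b) \<longrightarrow> f \<circ> sinf_fun (sum_list \<rho>s) = f)"
      using \<rho>s
    proof (induction \<rho>s)
      case Nil
      then show ?case by (simp add: zero_sinf.rep_eq)
    next
      case (Cons \<rho> \<rho>s)
      then have "\<forall>\<rho>\<in>set \<rho>s. transposition \<rho>" by simp
      from Cons.IH[OF this] obtain ps where ps: "length ps = length \<rho>s"
        "\<And>f :: nat \<Rightarrow> nat. (\<forall>(a, b) \<in> set ps. f a = f b) \<Longrightarrow> f \<circ> sinf_fun (sum_list \<rho>s) = f"
        by blast
      obtain a b where ab: "sinf_fun \<rho> = Transposition.transpose a b"
        using Cons.prems by (auto simp: transposition_def)
      have "f \<circ> sinf_fun (sum_list (\<rho> # \<rho>s)) = f"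
        if "\<forall>(a, b) \<in> set ((a, b) # ps). f a = f b" for f :: "nat \<Rightarrow> nat"
      proof -
        have "f \<circ> Transposition.transpose a b = f" using that by (simp add: comp_transpose_eq_iff)
        then show ?thesis using ps(2)[of f] that by (simp add: sinf_fun_add ab o_assoc)
      qed
      then show ?case using ps(1) by (intro exI[of _ "(a, b) # ps"]) auto
    qed
    then show ?thesis using that by blast
  qed
  have "d ^ N \<le> card {f \<in> colourings d N. \<forall>(a, b) \<in> set ps. f a = f b} * d ^ length ps"
    by (rule card_equalizer_ge[OF d])
  also have "\<dots> \<le> card (invariant_colourings d N (sum_list \<rho>s)) * d ^ length ps"
    unfolding invariant_colourings_def
    by (intro mult_right_mono card_mono) (use ps(2) in auto)
  finally show ?thesis by (simp add: ps(1))
qed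

text \<open>Multiplying \<open>\<tau>\<close> by the transposition of \<open>a\<close> and \<open>\<tau> a\<close> splits the point \<open>a\<close> off its cycle and
  frees its colour.\<close>

lemma ex_factorization_card_invariant:
  assumes d: "d \<ge> 1" and \<tau>: "\<tau> \<in> supported N"
  shows "\<exists>\<rho>s. (\<forall>\<rho>\<in>set \<rho>s. transposition \<rho>) \<and> \<tau> = sum_list \<rho>s \<and>
    card (invariant_colourings d N \<tau>) * d ^ length \<rho>s = d ^ N"
  using \<tau>
proof (induction "card {p \<in> {1..N}. sinf_fun \<tau> p \<noteq> p}" arbitrary: \<tau> rule: less_induct)
  case less
  show ?case
  proof (cases "\<tau> = 0")
    case True
    then have "invariant_colourings d N \<tau> = colourings d N"
      by (simp add: invariant_colourings_def zero_sinf.rep_eq)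
    then show ?thesis by (intro exI[of _ "[]"]) (simp add: True card_colourings)
  next
    case False
    then obtain a where a: "sinf_fun \<tau> a \<noteq> a"
      by (metis sinf_fun_inject zero_sinf.rep_eq eq_id_iff)
    define b where "b = sinf_fun \<tau> a"
    have aN: "a \<le> N" using a less.prems by (auto simp: supported_def not_le[symmetric])
    have a1: "1 \<le> a" using a sinf_fun_0_point[of \<tau>] by (cases a) auto
    have b1: "1 \<le> b" using a1 sinf_fun_ge_1 by (simp add: b_def)
    have bN: "b \<le> N" using supported_le[OF less.prems aN] by (simp add: b_def)
    have ab: "a \<noteq> b" using a by (simp add: b_def)
    define \<tau>' where "\<tau>' = swap a b + \<tau>"
    have fs: "sinf_fun (swap a b) = Transposition.transpose a b" by (rule sinf_fun_swap[OF a1 b1])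
    have f': "sinf_fun \<tau>' = Transposition.transpose a b \<circ> sinf_fun \<tau>"
      by (simp add: \<tau>'_def sinf_fun_add fs)
    have "swap a b + swap a b = 0"
      by (intro sinf_fun_inject[THEN iffD1]) (simp add: sinf_fun_add fs zero_sinf.rep_eq)
    then have \<tau>_eq: "\<tau> = swap a b + \<tau>'" by (simp add: \<tau>'_def add.assoc[symmetric])
    have f_eq: "sinf_fun \<tau> = Transposition.transpose a b \<circ> sinf_fun \<tau>'"
      by (subst \<tau>_eq) (simp add: sinf_fun_add fs)
    have fix_a: "sinf_fun \<tau>' a = a" by (simp add: f' b_def[symmetric])
    have "swap a b \<in> supported N" using aN bN by (auto simp: supported_def fs Transposition.transpose_def)
    then have supp': "\<tau>' \<in> supported N" unfolding \<tau>'_def using less.prems by (rule supported_add)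
    \<comment> \<open>The new permutation could only move an additional point at \<open>a\<close> or
      \<open>b\<close>; both are already moved by \<open>\<tau>\<close>, and \<open>a\<close>
      becomes fixed, so the number of moved points drops.\<close>
    have "sinf_fun \<tau> b \<noteq> b" using a injD[OF inj_sinf_fun[of \<tau>], of b a] by (auto simp: b_def)
    then have "{p \<in> {1..N}. sinf_fun \<tau>' p \<noteq> p} \<subset> {p \<in> {1..N}. sinf_fun \<tau> p \<noteq> p}"
      using a a1 aN fix_a by (auto simp: f' Transposition.transpose_def split: if_splits)
    then have "card {p \<in> {1..N}. sinf_fun \<tau>' p \<noteq> p} < card {p \<in> {1..N}. sinf_fun \<tau> p \<noteq> p}"
      by (intro psubset_card_mono) auto
    from less.hyps[OF this supp'] obtain \<rho>s where \<rho>s: "\<forall>\<rho>\<in>set \<rho>s. transposition \<rho>" "\<tau>' = sum_list \<rho>s"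
      "card (invariant_colourings d N \<tau>') * d ^ length \<rho>s = d ^ N" by blast
    have inv: "f \<in> invariant_colourings d N \<tau> \<longleftrightarrow> f \<in> invariant_colourings d N \<tau>' \<and> f a = f b" for f
    proof -
      have "f a = f b" if "f \<circ> sinf_fun \<tau> = f" using fun_cong[OF that, of a] by (simp add: b_def)
      moreover have "f \<circ> sinf_fun \<tau> = f \<longleftrightarrow> f \<circ> sinf_fun \<tau>' = f" if "f a = f b"
      proof -
        have "f \<circ> Transposition.transpose a b = f" using that by (simp add: comp_transpose_eq_iff)
        then have "f \<circ> sinf_fun \<tau> = f \<circ> sinf_fun \<tau>'" by (simp add: f_eq o_assoc)
        then show ?thesis by simp
      qed
      ultimately show ?thesis by (auto simp: invariant_colourings_def)
    qed
    have upd: "f(a := c) \<in> invariant_colourings d N \<tau>'" if "f \<in> invariant_colourings d N \<tau>'" "c < d" for f c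
    proof -
      have "f(a := c) \<circ> sinf_fun \<tau>' = (f \<circ> sinf_fun \<tau>')(a := c)"
        using fix_a injD[OF inj_sinf_fun[of \<tau>'], of _ a] by (auto simp: fun_eq_iff)
      then show ?thesis
        using that a1 aN by (auto simp: invariant_colourings_def colourings_def PiE_dflt_def)
    qed
    \<comment> \<open>An invariant colouring of \<open>\<tau>'\<close> is one of
      \<open>\<tau>\<close> with the colour of \<open>a\<close> overwritten freely. The inverse
      remembers that colour and restores the forced one, \<open>f b\<close>.\<close>
    have "bij_betw (\<lambda>(c, f). f(a := c)) ({..<d} \<times> invariant_colourings d N \<tau>) (invariant_colourings d N \<tau>')"
    proof (rule bij_betwI[where g = "\<lambda>f. (f a, f(a := f b))"])
      show "(\<lambda>(c, f). f(a := c)) \<in> {..<d} \<times> invariant_colourings d N \<tau> \<rightarrow> invariant_colourings d N \<tau>'"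
        using upd inv by auto
      show "(\<lambda>f. (f a, f(a := f b))) \<in> invariant_colourings d N \<tau>' \<rightarrow> {..<d} \<times> invariant_colourings d N \<tau>"
      proof
        fix f assume f: "f \<in> invariant_colourings d N \<tau>'"
        then have "f p < d" for p using d by (auto simp: invariant_colourings_def intro: colourings_lt)
        then show "(f a, f(a := f b)) \<in> {..<d} \<times> invariant_colourings d N \<tau>"
          using upd[OF f] inv ab by simp
      qed
    qed (use inv ab in \<open>auto simp: fun_eq_iff\<close>)
    then have "card (invariant_colourings d N \<tau>') = d * card (invariant_colourings d N \<tau>)"
      by (auto dest!: bij_betw_same_card simp: card_cartesian_product)
    then show ?thesis
      using \<rho>s \<tau>_eq transposition_swap[OF a1 b1 ab]
      by (intro exI[of _ "swap a b # \<rho>s"]) (auto simp: mult_ac)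
  qed
qed

text \<open>A squeeze: a shortest factorization gives one inequality, and the explicit one, which is
  at least as long, gives the other. The explicit factorization is not claimed to be shortest; for
  \<open>d = 1\<close> the count could not detect this, and only the power of \<open>d\<close>
  matters.\<close>

lemma card_invariant_colourings:
  assumes d: "d \<ge> 1" and \<tau>: "\<tau> \<in> supported N"
  shows "card (invariant_colourings d N \<tau>) * d ^ perm_length \<tau> = d ^ N"
proof -
  let ?P = "\<lambda>m. \<exists>\<rho>s. length \<rho>s = m \<and> (\<forall>\<rho>\<in>set \<rho>s. transposition \<rho>) \<and> \<tau> = sum_list \<rho>s"
  obtain \<rho>s where \<rho>s: "\<forall>\<rho>\<in>set \<rho>s. transposition \<rho>" "\<tau> = sum_list \<rho>s"
    "card (invariant_colourings d N \<tau>) * d ^ length \<rho>s = d ^ N"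
    using ex_factorization_card_invariant[OF assms] by blast
  have "?P (length \<rho>s)" using \<rho>s by blast
  then have P: "?P (perm_length \<tau>)" and le: "perm_length \<tau> \<le> length \<rho>s"
    unfolding perm_length_def by (rule LeastI, intro Least_le)
  from P obtain \<sigma>s where "length \<sigma>s = perm_length \<tau>" "\<forall>\<rho>\<in>set \<sigma>s. transposition \<rho>" "\<tau> = sum_list \<sigma>s"
    by blast
  then have "d ^ N \<le> card (invariant_colourings d N \<tau>) * d ^ perm_length \<tau>"
    using card_invariant_ge[OF d, of \<sigma>s N] by simp
  moreover have "card (invariant_colourings d N \<tau>) * d ^ perm_length \<tau> \<le> d ^ N"
    using \<rho>s(3) le d power_increasing[of "perm_length \<tau>" "length \<rho>s" d]
    by (metis mult_le_mono2)
  ultimately show ?thesis by simp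
qed

text \<open>Permuting the points of a colouring by composition on the right is a left action on
  functions of colourings, which is why \<open>act_mult\<close> has no reversal of factors.\<close>

definition act :: "group_algebra \<Rightarrow> ((nat \<Rightarrow> nat) \<Rightarrow> complex) \<Rightarrow> (nat \<Rightarrow> nat) \<Rightarrow> complex" where
  "act x \<psi> f = (\<Sum>\<tau>\<in>Poly_Mapping.keys x. Poly_Mapping.lookup x \<tau> * \<psi> (f \<circ> sinf_fun \<tau>))"

lemma act_superset:
  assumes "finite S" "Poly_Mapping.keys x \<subseteq> S"
  shows "act x \<psi> f = (\<Sum>\<tau>\<in>S. Poly_Mapping.lookup x \<tau> * \<psi> (f \<circ> sinf_fun \<tau>))"
  unfolding act_def using assms
  by (intro sum.mono_neutral_left) (auto simp: in_keys_iff)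

lemma act_add: "act (x + y) \<psi> f = act x \<psi> f + act y \<psi> f"
proof -
  let ?S = "Poly_Mapping.keys x \<union> Poly_Mapping.keys y"
  have "Poly_Mapping.keys (x + y) \<subseteq> ?S" by (rule Poly_Mapping.keys_add)
  then show ?thesis
    by (simp add: act_superset[of ?S] Poly_Mapping.lookup_add algebra_simps sum.distrib)
qed

lemma act_single: "act (Poly_Mapping.single \<tau> c) \<psi> f = c * \<psi> (f \<circ> sinf_fun \<tau>)"
  by (subst act_superset[of "{\<tau>}"]) auto

lemma act_0: "act 0 \<psi> f = 0"
  by (simp add: act_def)

lemma act_uminus: "act (- x) \<psi> f = - act x \<psi> f"
  using act_add[of x "- x" \<psi> f] by (simp add: act_0 add_eq_0_iff)

lemma act_diff: "act (x - y) \<psi> f = act x \<psi> f - act y \<psi> f"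
  using act_add[of x "- y" \<psi> f] by (simp add: act_uminus)

lemma act_sum: "act (\<Sum>i\<in>I. x i) \<psi> f = (\<Sum>i\<in>I. act (x i) \<psi> f)"
  by (induction I rule: infinite_finite_induct) (simp_all add: act_0 act_add)

lemma poly_mapping_add_single_induct:
  fixes x :: "'b \<Rightarrow>\<^sub>0 'c::monoid_add"
  assumes "P 0" "\<And>\<tau> c y. P y \<Longrightarrow> P (Poly_Mapping.single \<tau> c + y)"
  shows "P x"
proof (induction x rule: Poly_Mapping.update_induct)
  case const
  then show ?case by fact
next
  case (update f k v)
  have "Poly_Mapping.update k v f = Poly_Mapping.single k v + f"
    by (rule poly_mapping_eqI)
       (use update(1) in \<open>auto simp: lookup_update lookup_add lookup_single in_keys_iff when_def\<close>)
  then show ?case using assms(2)[OF update(3)] by simp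
qed

lemma act_mult: "act (x * y) \<psi> f = act x (act y \<psi>) f"
proof (induction x rule: poly_mapping_add_single_induct)
  case 1
  then show ?case by (simp add: act_0)
next
  case (2 \<tau> c x)
  have "act (Poly_Mapping.single \<tau> c * y) \<psi> f = act (Poly_Mapping.single \<tau> c) (act y \<psi>) f"
  proof (induction y rule: poly_mapping_add_single_induct)
    case 1
    then show ?case by (simp add: act_0 act_single)
  next
    case (2 \<sigma> e y)
    then show ?case
      by (simp add: distrib_left act_add Poly_Mapping.mult_single act_single sinf_fun_add o_assoc algebra_simps)
  qed
  then show ?case using 2 by (simp add: distrib_right act_add)
qed

text \<open>The diagonal entry of a permutation at \<open>f\<close> is 1 exactly when
  \<open>f\<close> is invariant, so its trace is the number of invariant colourings. All
  permutations in \<open>x\<close> must be supported on the same \<open>N\<close> points for one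
  trace to serve them all.\<close>

lemma phi_eq_trace:
  assumes d: "d \<ge> 1" and x: "Poly_Mapping.keys x \<subseteq> supported N"
  shows "phi d x = (1 / of_nat d) ^ N *
    (\<Sum>f\<in>colourings d N. act x (\<lambda>g. if g = f then 1 else 0) f)"
proof -
  have card: "(\<Sum>f\<in>colourings d N. if f \<circ> sinf_fun \<tau> = f then 1 else 0) =
      (of_nat d ^ N * (1 / of_nat d) ^ perm_length \<tau> :: complex)" if "\<tau> \<in> Poly_Mapping.keys x" for \<tau>
  proof -
    have "card (invariant_colourings d N \<tau>) * d ^ perm_length \<tau> = d ^ N"
      using card_invariant_colourings[OF d, of \<tau> N] that x by blast
    then have "complex_of_nat (card (invariant_colourings d N \<tau>) * d ^ perm_length \<tau>) = of_nat (d ^ N)"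
      by (simp only:)
    then have "of_nat (card (invariant_colourings d N \<tau>)) = (of_nat d ^ N * (1 / of_nat d) ^ perm_length \<tau> :: complex)"
      using d by (simp add: field_simps)
    then show ?thesis
      by (simp add: invariant_colourings_def sum.If_cases Int_def)
  qed
  have "(\<Sum>f\<in>colourings d N. act x (\<lambda>g. if g = f then 1 else 0) f) =
      (\<Sum>\<tau>\<in>Poly_Mapping.keys x. Poly_Mapping.lookup x \<tau> *
        (\<Sum>f\<in>colourings d N. if f \<circ> sinf_fun \<tau> = f then 1 else 0))"
    unfolding act_def sum_distrib_left by (rule sum.swap)
  also have "\<dots> = (\<Sum>\<tau>\<in>Poly_Mapping.keys x. Poly_Mapping.lookup x \<tau> *
      (of_nat d ^ N * (1 / of_nat d) ^ perm_length \<tau>))"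
    by (intro sum.cong refl arg_cong[where f = "(*) _"] card)
  also have "\<dots> = of_nat d ^ N * phi d x"
    unfolding phi_def sum_distrib_left by (intro sum.cong refl) (simp add: mult_ac)
  finally show ?thesis using d by (simp add: field_simps)
qed

text \<open>Position 0 of the list is the point 1, so the head is the colour moved by every star
  generator and the tail lists the other sites. The value 0 elsewhere matches
  \<open>colourings\<close>.\<close>

definition colouring_of :: "nat list \<Rightarrow> nat \<Rightarrow> nat" where
  "colouring_of l p = (if 1 \<le> p \<and> p \<le> length l then l ! (p - 1) else 0)"

lemma colouring_of_inj: "length l = length l' \<Longrightarrow> colouring_of l = colouring_of l' \<Longrightarrow> l = l'"
proof (rule nth_equalityI)
  fix i assume eq: "colouring_of l = colouring_of l'" and i: "i < length l" "length l = length l'"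
  show "l ! i = l' ! i"
    using fun_cong[OF eq, of "Suc i"] i by (simp add: colouring_of_def)
qed

lemma bij_betw_colouring_of: "bij_betw colouring_of (configs d n) (colourings d n)"
  unfolding bij_betw_def
proof
  show "inj_on colouring_of (configs d n)"
    by (intro inj_onI colouring_of_inj) (auto simp: configs_def)
  show "colouring_of ` configs d n = colourings d n"
  proof (intro equalityI subsetI)
    fix f assume "f \<in> colouring_of ` configs d n"
    then obtain l where l: "length l = n" "set l \<subseteq> {..<d}" "f = colouring_of l"
      by (auto simp: configs_def)
    then show "f \<in> colourings d n"
      by (auto simp: colourings_def PiE_dflt_def colouring_of_def subset_eq)
  next
    fix f assume f: "f \<in> colourings d n"
    define l where "l = map (\<lambda>i. f (Suc i)) [0..<n]"
    have "l \<in> configs d n" using f by (auto simp: l_def configs_def colourings_def PiE_dflt_def)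
    moreover have "f = colouring_of l"
      using f by (auto simp: l_def colouring_of_def colourings_def PiE_dflt_def fun_eq_iff)
    ultimately show "f \<in> colouring_of ` configs d n" by blast
  qed
qed

text \<open>\<open>star_gen (Suc i)\<close> exchanges the points 1 and \<open>i + 2\<close>; the
  latter is position \<open>i\<close> of the tail.\<close>

lemma colouring_of_comp_star_gen:
  assumes "i < length h"
  shows "colouring_of (a # h) \<circ> sinf_fun (star_gen (Suc i)) = colouring_of (h ! i # h[i := a])"
proof
  fix p
  consider "p = 1" | "p = Suc (Suc i)" | "p \<noteq> 1" "p \<noteq> Suc (Suc i)" by blast
  then show "(colouring_of (a # h) \<circ> sinf_fun (star_gen (Suc i))) p = colouring_of (h ! i # h[i := a]) p"
  proof cases
    case 3
    then have "(a # h) ! (p - 1) = (h ! i # h[i := a]) ! (p - 1)"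
      if "1 \<le> p" "p \<le> Suc (length h)"
      using that by (cases p; cases "p - 1") auto
    then show ?thesis
      using 3 by (auto simp: star_gen.rep_eq colouring_of_def Transposition.transpose_def)
  qed (use assms in \<open>auto simp: star_gen.rep_eq colouring_of_def Transposition.transpose_def\<close>)
qed

text \<open>With the head colour as matrix index, \<open>s_seq\<close> becomes a matrix of operators
  on the tail: going from head \<open>a\<close> to head \<open>b\<close> requires a site of colour
  \<open>b\<close>, which then receives \<open>a\<close>.\<close>

lemma act_s_seq:
  assumes d: "d \<ge> 1" and a: "a < d" and h: "length h = n" "set h \<subseteq> {..<d}"
  shows "act (s_seq d n) \<psi> (colouring_of (a # h)) = of_real (1 / sqrt (real n)) *
    (\<Sum>b<d. site_sum d (a, b) (\<lambda>h'. \<psi> (colouring_of (b # h'))) h)"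
proof -
  let ?c = colouring_of
  have "act (s_seq d n) \<psi> (?c (a # h)) = of_real (1 / sqrt (real n)) *
      ((\<Sum>i = 1..n. \<psi> (?c (a # h) \<circ> sinf_fun (star_gen i))) - of_nat n / of_nat d * \<psi> (?c (a # h)))"
    by (simp add: s_seq_def act_mult scalar_def grp_def act_diff act_sum act_single zero_sinf.rep_eq)
  also have "(\<Sum>i = 1..n. \<psi> (?c (a # h) \<circ> sinf_fun (star_gen i))) =
      (\<Sum>i<n. \<psi> (?c (a # h) \<circ> sinf_fun (star_gen (Suc i))))"
    by (simp add: sum.atLeast1_atMost_eq)
  also have "\<dots> = (\<Sum>i<n. \<psi> (?c (h ! i # h[i := a])))"
    by (intro sum.cong refl) (simp add: colouring_of_comp_star_gen h(1))
  also have "\<dots> - of_nat n / of_nat d * \<psi> (?c (a # h)) =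
      (\<Sum>i<n. \<psi> (?c (h ! i # h[i := a])) - \<psi> (?c (a # h)) / of_nat d)"
    by (simp add: sum_subtractf)
  \<comment> \<open>The new head colour is made a summation index: the first term lives on
    \<open>b = h ! i\<close>, the centring on \<open>b = a\<close>. Both values lie below
    \<open>d\<close>.\<close>
  also have "\<dots> = (\<Sum>i<n. \<Sum>b<d. (if h ! i = b then \<psi> (?c (b # h[i := a])) else 0) -
      (if a = b then \<psi> (?c (b # h)) / of_nat d else 0))"
  proof (rule sum.cong[OF refl])
    fix i assume "i \<in> {..<n}"
    then have "h ! i \<in> set h" using h by simp
    then have "h ! i < d" using h(2) by auto
    then show "\<psi> (?c (h ! i # h[i := a])) - \<psi> (?c (a # h)) / of_nat d =
      (\<Sum>b<d. (if h ! i = b then \<psi> (?c (b # h[i := a])) else 0) -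
      (if a = b then \<psi> (?c (b # h)) / of_nat d else 0))"
      using a by (simp add: sum_subtractf sum.delta')
  qed
  also have "\<dots> = (\<Sum>b<d. site_sum d (a, b) (\<lambda>h'. \<psi> (?c (b # h'))) h)"
    by (subst sum.swap) (simp add: h(1))
  finally show ?thesis .
qed

text \<open>Multiplying the operator-valued matrices yields the path expansion, in which the
  operators along a path keep their order.\<close>

lemma act_s_seq_power:
  assumes d: "d \<ge> 1" and "a < d" "length h = n" "set h \<subseteq> {..<d}"
  shows "act (s_seq d n ^ k) \<psi> (colouring_of (a # h)) = of_real (1 / sqrt (real n)) ^ k *
    (\<Sum>b<d. path_sum d k a b (\<lambda>w. foldr (site_sum d) w (\<lambda>h'. \<psi> (colouring_of (b # h'))) h))"
  using assms(2-)
proof (induction k arbitrary: a h)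
  case 0
  have "act 1 \<psi> f = \<psi> f" for f
    by (simp add: act_single zero_sinf.rep_eq flip: single_one)
  then show ?case
    using 0 by (simp add: sum.delta')
next
  case (Suc k)
  let ?r = "complex_of_real (1 / sqrt (real n))"
  let ?G = "\<lambda>b w. foldr (site_sum d) w (\<lambda>h'. \<psi> (colouring_of (b # h')))"
  have "act (s_seq d n ^ Suc k) \<psi> (colouring_of (a # h)) =
      ?r * (\<Sum>c<d. site_sum d (a, c) (\<lambda>h'. act (s_seq d n ^ k) \<psi> (colouring_of (c # h'))) h)"
    unfolding power_Suc act_mult by (rule act_s_seq[OF d Suc.prems])
  also have "(\<Sum>c<d. site_sum d (a, c) (\<lambda>h'. act (s_seq d n ^ k) \<psi> (colouring_of (c # h'))) h) =
      (\<Sum>c<d. site_sum d (a, c) (\<lambda>h'. ?r ^ k * (\<Sum>b<d. path_sum d k c b (\<lambda>w. ?G b w h'))) h)"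
    by (intro sum.cong refl site_sum_cong[OF Suc.prems] Suc.IH) auto
  also have "\<dots> = (\<Sum>c<d. ?r ^ k * (\<Sum>b<d. path_sum d k c b (\<lambda>w. site_sum d (a, c) (?G b w) h)))"
    by (simp only: site_sum_scale site_sum_sum site_sum_path_sum)
  also have "\<dots> = ?r ^ k * (\<Sum>b<d. path_sum d (Suc k) a b (\<lambda>w. ?G b w h))"
    unfolding sum_distrib_left[symmetric] path_sum.simps foldr.simps o_apply
    by (rule arg_cong[where f = "(*) _"]) (rule sum.swap)
  finally show ?case by (simp add: mult.assoc)
qed

text \<open>The same \<open>n + 1\<close> points carry all powers, so \<open>phi\<close> of each of
  them is a trace over a number of sites independent of \<open>k\<close>.\<close>

lemma keys_s_seq_power: "Poly_Mapping.keys (s_seq d n ^ k) \<subseteq> supported (Suc n)"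
proof -
  have zero: "0 \<in> supported (Suc n)" by (simp add: supported_def zero_sinf.rep_eq)
  have mult: "Poly_Mapping.keys (x * y) \<subseteq> supported (Suc n)"
    if "Poly_Mapping.keys x \<subseteq> supported (Suc n)" "Poly_Mapping.keys y \<subseteq> supported (Suc n)"
    for x y :: group_algebra
    using keys_mult[of x y] that supported_add by blast
  have sc: "Poly_Mapping.keys (scalar c) \<subseteq> supported (Suc n)" for c
    using zero by (simp add: scalar_def)
  have "star_gen i \<in> supported (Suc n)" if "i \<in> {1..n}" for i
    using that by (auto simp: supported_def star_gen.rep_eq Transposition.transpose_def)
  then have "Poly_Mapping.keys (\<Sum>i = 1..n. grp (star_gen i)) \<subseteq> supported (Suc n)"
    by (intro order_trans[OF keys_sum]) (auto simp: grp_def)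
  then have "Poly_Mapping.keys ((\<Sum>i = 1..n. grp (star_gen i)) - scalar (of_nat n / of_nat d)) \<subseteq> supported (Suc n)"
    using sc by (intro order_trans[OF keys_diff]) auto
  then have s: "Poly_Mapping.keys (s_seq d n) \<subseteq> supported (Suc n)"
    unfolding s_seq_def by (rule mult[OF sc])
  show ?thesis
  proof (induction k)
    case 0
    then show ?case using zero by simp
  next
    case (Suc k)
    then show ?case using mult[OF s] by simp
  qed
qed

text \<open>The trace is taken in two stages: over the head it closes the paths, over the tail it
  yields \<open>config_trace\<close>. One factor \<open>1 / d\<close> belongs to the head.\<close>

lemma phi_s_seq_power:
  assumes d: "d \<ge> 1"
  shows "phi d (s_seq d n ^ k) = of_real (1 / sqrt (real n)) ^ k *
    ((1 / of_nat d) * (\<Sum>a<d. path_sum d k a a (wpow (site_trace d) n)))"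
proof -
  let ?r = "complex_of_real (1 / sqrt (real n))"
  let ?\<delta> = "\<lambda>f g. if g = f then 1 else 0 :: complex"
  let ?c = colouring_of
  have "phi d (s_seq d n ^ k) = (1 / of_nat d) ^ Suc n *
      (\<Sum>f\<in>colourings d (Suc n). act (s_seq d n ^ k) (?\<delta> f) f)"
    by (rule phi_eq_trace[OF d keys_s_seq_power])
  also have "(\<Sum>f\<in>colourings d (Suc n). act (s_seq d n ^ k) (?\<delta> f) f) =
      (\<Sum>l\<in>configs d (Suc n). act (s_seq d n ^ k) (?\<delta> (?c l)) (?c l))"
    by (rule sum.reindex_bij_betw[OF bij_betw_colouring_of, symmetric])
  also have "\<dots> = (\<Sum>a<d. \<Sum>h\<in>configs d n. act (s_seq d n ^ k) (?\<delta> (?c (a # h))) (?c (a # h)))"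
    by (rule sum_configs_Suc)
  also have "\<dots> = (\<Sum>a<d. \<Sum>h\<in>configs d n. ?r ^ k *
      path_sum d k a a (\<lambda>w. foldr (site_sum d) w (?\<delta> h) h))"
  proof (intro sum.cong refl)
    fix a h assume a: "a \<in> {..<d}" and h: "h \<in> configs d n"
    let ?\<psi> = "\<lambda>b h'. if b = a \<and> h' = h then 1 else 0 :: complex"
    have "act (s_seq d n ^ k) (?\<delta> (?c (a # h))) (?c (a # h)) = ?r ^ k *
      (\<Sum>b<d. path_sum d k a b (\<lambda>w. foldr (site_sum d) w (\<lambda>h'. ?\<delta> (?c (a # h)) (?c (b # h'))) h))"
      using a h by (intro act_s_seq_power[OF d]) (auto simp: configs_def)
    also have "(\<Sum>b<d. path_sum d k a b (\<lambda>w. foldr (site_sum d) w (\<lambda>h'. ?\<delta> (?c (a # h)) (?c (b # h'))) h)) =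
      (\<Sum>b<d. if b = a then path_sum d k a a (\<lambda>w. foldr (site_sum d) w (?\<delta> h) h) else 0)"
    proof (rule sum.cong[OF refl])
      fix b assume b: "b \<in> {..<d}"
      \<comment> \<open>The indicator of \<open>a # h\<close> is the product of the indicators of
        \<open>a\<close> and \<open>h\<close>. Injectivity of \<open>colouring_of\<close> requires
        equal lengths, which site operators preserve.\<close>
      have "foldr (site_sum d) w (\<lambda>h'. ?\<delta> (?c (a # h)) (?c (b # h'))) h =
          foldr (site_sum d) w (\<lambda>h'. if b = a then ?\<delta> h h' else 0) h" for w
      proof (rule foldr_site_sum_cong)
        fix h' :: "nat list" assume "length h' = length h"
        then show "?\<delta> (?c (a # h)) (?c (b # h')) = (if b = a then ?\<delta> h h' else 0)"
          using colouring_of_inj[of "b # h'" "a # h"] by auto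
      qed
      then show "path_sum d k a b (\<lambda>w. foldr (site_sum d) w (\<lambda>h'. ?\<delta> (?c (a # h)) (?c (b # h'))) h) =
        (if b = a then path_sum d k a a (\<lambda>w. foldr (site_sum d) w (?\<delta> h) h) else 0)"
        using path_sum_scale[of d k a b 0 "\<lambda>w. 0 :: complex"] by (simp add: foldr_site_sum_zero)
    qed
    also have "\<dots> = path_sum d k a a (\<lambda>w. foldr (site_sum d) w (?\<delta> h) h)"
      using a by simp
    finally show "act (s_seq d n ^ k) (?\<delta> (?c (a # h))) (?c (a # h)) = ?r ^ k *
      path_sum d k a a (\<lambda>w. foldr (site_sum d) w (?\<delta> h) h)" .
  qed
  also have "\<dots> = ?r ^ k * (\<Sum>a<d. path_sum d k a a (\<lambda>w. \<Sum>h\<in>configs d n. foldr (site_sum d) w (?\<delta> h) h))"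
    by (simp add: sum_distrib_left[symmetric] path_sum_sum)
  also have "(1 / of_nat d) ^ Suc n * \<dots> = ?r ^ k * ((1 / of_nat d) *
      (\<Sum>a<d. path_sum d k a a (config_trace d n)))"
    unfolding config_trace_def[abs_def] path_sum_scale
    by (simp add: sum_distrib_left[symmetric] mult_ac)
  finally show ?thesis by (simp only: config_trace_eq_wpow)
qed

section \<open>Moments of Gaussian families\<close>

definition normal_moment :: "real \<Rightarrow> nat \<Rightarrow> real" where
  "normal_moment \<sigma> k = (\<integral>x. normal_density 0 \<sigma> x * x ^ k \<partial>lborel)"

lemma normal_moment_0: "\<sigma> > 0 \<Longrightarrow> normal_moment \<sigma> 0 = 1"
  using normal_moment_even[of \<sigma> 0 0]
  by (simp add: normal_moment_def has_bochner_integral_integral_eq)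

lemma normal_moment_even_eq:
  "\<sigma> > 0 \<Longrightarrow> normal_moment \<sigma> (2 * k) = fact (2 * k) / ((2 / \<sigma>\<^sup>2) ^ k * fact k)"
  using has_bochner_integral_integral_eq[OF normal_moment_even[of \<sigma> 0 k]]
  by (simp add: normal_moment_def)

lemma normal_moment_odd_eq: "\<sigma> > 0 \<Longrightarrow> normal_moment \<sigma> (Suc (2 * k)) = 0"
  using has_bochner_integral_integral_eq[OF normal_moment_odd[of \<sigma> 0 k]]
  by (simp add: normal_moment_def)

text \<open>Gaussian integration by parts for powers, read off from the closed formulas. At
  \<open>k = 0\<close> the truncated \<open>k - 1\<close> is harmless because its factor is
  0.\<close>

lemma normal_moment_Suc:
  assumes "\<sigma> > 0"
  shows "normal_moment \<sigma> (Suc k) = \<sigma>\<^sup>2 * real k * normal_moment \<sigma> (k - 1)"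
proof (cases "even k")
  case True
  then obtain j where k: "k = 2 * j" by (elim evenE)
  show ?thesis
  proof (cases j)
    case 0
    then show ?thesis using assms normal_moment_odd_eq[of \<sigma> 0] by (simp add: k)
  next
    case (Suc i)
    then have "k - 1 = Suc (2 * i)" by (simp add: k)
    then show ?thesis using assms by (simp add: k normal_moment_odd_eq)
  qed
next
  case False
  then obtain j where k: "k = 2 * j + 1" by (elim oddE)
  then have "Suc k = 2 * Suc j" "k - 1 = 2 * j" by auto
  moreover have "normal_moment \<sigma> (2 * Suc j) = \<sigma>\<^sup>2 * real (2 * j + 1) * normal_moment \<sigma> (2 * j)"
  proof -
    have cancel: "2 * z * y * F / (2 / s * z * D) = s * y * (F / D)"
      if "s > 0" "z > 0" for z y s F D :: real
      using that by (simp add: field_simps)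
    have "fact (2 * Suc j) = 2 * (real j + 1) * real (2 * j + 1) * fact (2 * j)"
      by (simp add: algebra_simps)
    moreover have "(2 / \<sigma>\<^sup>2) ^ Suc j * fact (Suc j) = 2 / \<sigma>\<^sup>2 * (real j + 1) * ((2 / \<sigma>\<^sup>2) ^ j * fact j)"
      by (simp add: algebra_simps)
    ultimately show ?thesis
      unfolding normal_moment_even_eq[OF assms] using assms cancel[of "\<sigma>\<^sup>2" "real j + 1"] by (simp only:) simp
  qed
  ultimately show ?thesis by (simp only: k)
qed

text \<open>The letters are coefficient vectors of linear forms. \<open>coord \<alpha>\<close> is
  the partial derivative of a one-letter word with respect to the variable of index
  \<open>\<alpha>\<close>.\<close>

definition coord :: "'i \<Rightarrow> ('i \<Rightarrow> complex) list \<Rightarrow> complex" where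
  "coord \<alpha> u = (case u of [c] \<Rightarrow> c \<alpha> | _ \<Rightarrow> 0)"

lemma coord_Cons: "(\<lambda>u. coord \<alpha> (c # u)) = (\<lambda>u. c \<alpha> * wone u)"
  by (auto simp: coord_def wone_def fun_eq_iff split: list.splits)

context prob_space
begin

definition gaussian_family :: "'i set \<Rightarrow> ('i \<Rightarrow> real) \<Rightarrow> ('i \<Rightarrow> 'a \<Rightarrow> real) \<Rightarrow> bool" where
  "gaussian_family I \<sigma> Z \<longleftrightarrow> finite I \<and> indep_vars (\<lambda>_. borel) Z I \<and>
     (\<forall>\<alpha>\<in>I. \<sigma> \<alpha> > 0 \<and> distributed M lborel (Z \<alpha>) (normal_density 0 (\<sigma> \<alpha>)))"

definition linear_form :: "'i set \<Rightarrow> ('i \<Rightarrow> 'a \<Rightarrow> real) \<Rightarrow> ('i \<Rightarrow> complex) \<Rightarrow> 'a \<Rightarrow> complex" where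
  "linear_form I Z c \<omega> = (\<Sum>\<alpha>\<in>I. c \<alpha> * of_real (Z \<alpha> \<omega>))"

definition monomial :: "'i set \<Rightarrow> ('i \<Rightarrow> 'a \<Rightarrow> real) \<Rightarrow> ('i \<Rightarrow> nat) \<Rightarrow> 'a \<Rightarrow> complex" where
  "monomial I Z m \<omega> = (\<Prod>\<alpha>\<in>I. of_real (Z \<alpha> \<omega>) ^ m \<alpha>)"

lemma gaussian_power:
  assumes "distributed M lborel X (normal_density 0 \<sigma>)" "\<sigma> > 0"
  shows "integrable M (\<lambda>\<omega>. X \<omega> ^ k)" "expectation (\<lambda>\<omega>. X \<omega> ^ k) = normal_moment \<sigma> k"
  using distributed_integrable[OF assms(1), of "\<lambda>x. x ^ k"] integrable_normal_moment[OF assms(2), of 0 k]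
    distributed_integral[OF assms(1), of "\<lambda>x. x ^ k"]
  by (simp_all add: normal_moment_def)

lemma gaussian_monomial:
  assumes G: "gaussian_family I \<sigma> Z"
  shows "integrable M (monomial I Z m)"
    and "integral\<^sup>L M (monomial I Z m) = (\<Prod>\<alpha>\<in>I. of_real (normal_moment (\<sigma> \<alpha>) (m \<alpha>)))"
proof -
  have I: "finite I" and ind: "indep_vars (\<lambda>_. borel) Z I"
    and Z: "\<And>\<alpha>. \<alpha> \<in> I \<Longrightarrow> \<sigma> \<alpha> > 0" "\<And>\<alpha>. \<alpha> \<in> I \<Longrightarrow> distributed M lborel (Z \<alpha>) (normal_density 0 (\<sigma> \<alpha>))"
    using G by (auto simp: gaussian_family_def)
  have ind': "indep_vars (\<lambda>_. borel) (\<lambda>\<alpha> \<omega>. Z \<alpha> \<omega> ^ m \<alpha>) I"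
    by (rule indep_vars_compose2[OF ind]) simp
  have eq: "monomial I Z m = (\<lambda>\<omega>. complex_of_real (\<Prod>\<alpha>\<in>I. Z \<alpha> \<omega> ^ m \<alpha>))"
    by (simp add: monomial_def fun_eq_iff)
  have "integrable M (\<lambda>\<omega>. \<Prod>\<alpha>\<in>I. Z \<alpha> \<omega> ^ m \<alpha>)"
    using gaussian_power(1)[OF Z(2,1)] by (intro indep_vars_integrable I ind')
  then show "integrable M (monomial I Z m)" unfolding eq by (rule integrable_of_real)
  have "expectation (\<lambda>\<omega>. \<Prod>\<alpha>\<in>I. Z \<alpha> \<omega> ^ m \<alpha>) = (\<Prod>\<alpha>\<in>I. expectation (\<lambda>\<omega>. Z \<alpha> \<omega> ^ m \<alpha>))"
    using gaussian_power(1)[OF Z(2,1)] by (intro indep_vars_lebesgue_integral I ind')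
  also have "\<dots> = (\<Prod>\<alpha>\<in>I. normal_moment (\<sigma> \<alpha>) (m \<alpha>))"
    using gaussian_power(2)[OF Z(2,1)] by (intro prod.cong refl)
  finally show "integral\<^sup>L M (monomial I Z m) = (\<Prod>\<alpha>\<in>I. of_real (normal_moment (\<sigma> \<alpha>) (m \<alpha>)))"
    unfolding eq integral_complex_of_real by simp
qed

lemma monomial_mult_linear_form:
  assumes "finite I"
  shows "monomial I Z m \<omega> * linear_form I Z c \<omega> = (\<Sum>\<beta>\<in>I. c \<beta> * monomial I Z (m(\<beta> := Suc (m \<beta>))) \<omega>)"
proof -
  have "monomial I Z (m(\<beta> := Suc (m \<beta>))) \<omega> = monomial I Z m \<omega> * of_real (Z \<beta> \<omega>)" if "\<beta> \<in> I" for \<beta>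
  proof -
    have "(\<Prod>x\<in>I - {\<beta>}. complex_of_real (Z x \<omega>) ^ (m(\<beta> := Suc (m \<beta>))) x) =
        (\<Prod>x\<in>I - {\<beta>}. of_real (Z x \<omega>) ^ m x)"
      by (intro prod.cong) auto
    then show ?thesis
      unfolding monomial_def prod.remove[OF assms that] by (simp add: mult_ac)
  qed
  then show ?thesis by (simp add: linear_form_def sum_distrib_left mult_ac cong: sum.cong)
qed

text \<open>The monomial in front of the word makes an induction on the word possible: each letter
  is expanded in coordinates and absorbed into the exponents.\<close>

definition mixed_moment :: "'i set \<Rightarrow> ('i \<Rightarrow> 'a \<Rightarrow> real) \<Rightarrow> ('i \<Rightarrow> nat) \<Rightarrow> ('i \<Rightarrow> complex) list \<Rightarrow> complex" where
  "mixed_moment I Z m w = (\<integral>\<omega>. monomial I Z m \<omega> * (\<Prod>c\<leftarrow>w. linear_form I Z c \<omega>) \<partial>M)"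

lemma monomial_mult_Cons:
  assumes "finite I"
  shows "monomial I Z m \<omega> * (\<Prod>c\<leftarrow>c # w. linear_form I Z c \<omega>) =
    (\<Sum>\<beta>\<in>I. c \<beta> * (monomial I Z (m(\<beta> := Suc (m \<beta>))) \<omega> * (\<Prod>c\<leftarrow>w. linear_form I Z c \<omega>)))"
  using monomial_mult_linear_form[OF assms, of Z m \<omega> c]
  by (simp add: sum_distrib_right mult.assoc[symmetric])

lemma integrable_mixed_moment:
  assumes G: "gaussian_family I \<sigma> Z"
  shows "integrable M (\<lambda>\<omega>. monomial I Z m \<omega> * (\<Prod>c\<leftarrow>w. linear_form I Z c \<omega>))"
proof (induction w arbitrary: m)
  case Nil
  then show ?case using gaussian_monomial(1)[OF G] by simp
next
  case (Cons c w)
  have I: "finite I" using G by (simp add: gaussian_family_def)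
  show ?case
    unfolding monomial_mult_Cons[OF I]
    by (intro Bochner_Integration.integrable_sum integrable_mult_right Cons.IH)
qed

lemma mixed_moment_Cons:
  assumes G: "gaussian_family I \<sigma> Z"
  shows "mixed_moment I Z m (c # w) = (\<Sum>\<beta>\<in>I. c \<beta> * mixed_moment I Z (m(\<beta> := Suc (m \<beta>))) w)"
proof -
  have I: "finite I" using G by (simp add: gaussian_family_def)
  show ?thesis
    unfolding mixed_moment_def monomial_mult_Cons[OF I]
    by (subst Bochner_Integration.integral_sum)
       (simp_all add: integrable_mixed_moment[OF G])
qed

text \<open>Integration by parts: the expectation of \<open>Z \<alpha>\<close> times a function is
  the variance times the expectation of its \<open>\<alpha>\<close>-derivative. The first summand
  differentiates the monomial, the second the word.\<close>

lemma mixed_moment_by_parts: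
  assumes G: "gaussian_family I \<sigma> Z" and \<alpha>: "\<alpha> \<in> I"
  shows "mixed_moment I Z (m(\<alpha> := Suc (m \<alpha>))) w = of_real ((\<sigma> \<alpha>)\<^sup>2) *
    (of_nat (m \<alpha>) * mixed_moment I Z (m(\<alpha> := m \<alpha> - 1)) w + wconv (coord \<alpha>) (mixed_moment I Z m) w)"
proof (induction w arbitrary: m)
  case Nil
  have I: "finite I" and \<sigma>: "\<sigma> \<alpha> > 0" using G \<alpha> by (auto simp: gaussian_family_def)
  have E: "mixed_moment I Z m [] = (\<Prod>\<alpha>\<in>I. of_real (normal_moment (\<sigma> \<alpha>) (m \<alpha>)))" for m
    using gaussian_monomial(2)[OF G, of m] by (simp add: mixed_moment_def)
  have upd: "mixed_moment I Z (m(\<alpha> := k)) [] = of_real (normal_moment (\<sigma> \<alpha>) k) *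
      (\<Prod>x\<in>I - {\<alpha>}. of_real (normal_moment (\<sigma> x) (m x)))" for k
  proof -
    have "(\<Prod>x\<in>I - {\<alpha>}. complex_of_real (normal_moment (\<sigma> x) ((m(\<alpha> := k)) x))) =
        (\<Prod>x\<in>I - {\<alpha>}. of_real (normal_moment (\<sigma> x) (m x)))"
      by (intro prod.cong) auto
    then show ?thesis unfolding E prod.remove[OF I \<alpha>] by simp
  qed
  show ?case
    unfolding upd normal_moment_Suc[OF \<sigma>] by (simp add: coord_def)
next
  case (Cons c w)
  let ?K = "mixed_moment I Z" and ?s = "complex_of_real ((\<sigma> \<alpha>)\<^sup>2)"
  let ?up = "\<lambda>\<beta> m. m(\<beta> := Suc (m \<beta>))" and ?down = "\<lambda>m. m(\<alpha> := m \<alpha> - 1)"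
  have I: "finite I" using G by (auto simp: gaussian_family_def)
  have comm: "?up \<beta> (?up \<alpha> m) = (?up \<beta> m)(\<alpha> := Suc (?up \<beta> m \<alpha>))" for \<beta>
    by auto
  have "?K (?up \<alpha> m) (c # w) = (\<Sum>\<beta>\<in>I. c \<beta> * ?K (?up \<beta> (?up \<alpha> m)) w)"
    by (rule mixed_moment_Cons[OF G])
  also have "\<dots> = (\<Sum>\<beta>\<in>I. c \<beta> * (?s * (of_nat (?up \<beta> m \<alpha>) * ?K (?down (?up \<beta> m)) w +
      wconv (coord \<alpha>) (?K (?up \<beta> m)) w)))"
    unfolding comm by (simp only: Cons.IH)
  also have "\<dots> = ?s * ((\<Sum>\<beta>\<in>I. c \<beta> * of_nat (?up \<beta> m \<alpha>) * ?K (?down (?up \<beta> m)) w) +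
      (\<Sum>\<beta>\<in>I. c \<beta> * wconv (coord \<alpha>) (?K (?up \<beta> m)) w))"
    by (simp only: sum_distrib_left distrib_left sum.distrib mult_ac)
  also have "(\<Sum>\<beta>\<in>I. c \<beta> * wconv (coord \<alpha>) (?K (?up \<beta> m)) w) =
      wconv (coord \<alpha>) (\<lambda>v. ?K m (c # v)) w"
    by (simp add: mixed_moment_Cons[OF G] wconv_sum_right wconv_scale_right)
  \<comment> \<open>For \<open>\<beta> = \<alpha>\<close> the raised exponent counts one more: the
    surplus is the derivative of the first letter, the rest that of the monomial. For
    \<open>m \<alpha> = 0\<close> only the surplus remains.\<close>
  also have "(\<Sum>\<beta>\<in>I. c \<beta> * of_nat (?up \<beta> m \<alpha>) * ?K (?down (?up \<beta> m)) w) =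
      (\<Sum>\<beta>\<in>I. (if \<beta> = \<alpha> then c \<alpha> * ?K m w else 0) + of_nat (m \<alpha>) * (c \<beta> * ?K (?up \<beta> (?down m)) w))"
  proof (rule sum.cong[OF refl])
    fix \<beta>
    show "c \<beta> * of_nat (?up \<beta> m \<alpha>) * ?K (?down (?up \<beta> m)) w =
      (if \<beta> = \<alpha> then c \<alpha> * ?K m w else 0) + of_nat (m \<alpha>) * (c \<beta> * ?K (?up \<beta> (?down m)) w)"
    proof (cases "\<beta> = \<alpha>")
      case True
      show ?thesis by (cases "m \<alpha>") (simp_all add: True fun_upd_idem algebra_simps)
    next
      case False
      then have "?down (?up \<beta> m) = ?up \<beta> (?down m)" by auto
      then show ?thesis using False by simp
    qed
  qed
  also have "\<dots> = c \<alpha> * ?K m w + of_nat (m \<alpha>) * ?K (?down m) (c # w)"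
    using I \<alpha> by (simp add: sum.distrib sum_distrib_left[symmetric] mixed_moment_Cons[OF G])
  finally show ?case
    by (simp only: wconv.simps coord_Cons wconv_scale_left wconv_wone_left add_ac)
qed

text \<open>The case of an empty monomial: the first letter is expanded in the variables, and
  integration by parts pairs each of them with a later letter.\<close>

theorem gaussian_wick:
  assumes G: "gaussian_family I \<sigma> Z"
  shows "wick_functional UNIV (\<lambda>c e. \<Sum>\<alpha>\<in>I. of_real ((\<sigma> \<alpha>)\<^sup>2) * c \<alpha> * e \<alpha>)
    (\<lambda>w. \<integral>\<omega>. (\<Prod>c\<leftarrow>w. linear_form I Z c \<omega>) \<partial>M)"
proof -
  let ?C = "\<lambda>c e. \<Sum>\<alpha>\<in>I. of_real ((\<sigma> \<alpha>)\<^sup>2) * c \<alpha> * e \<alpha>"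
  have W: "(\<integral>\<omega>. (\<Prod>c\<leftarrow>w. linear_form I Z c \<omega>) \<partial>M) = mixed_moment I Z (\<lambda>_. 0) w" for w
    by (simp add: mixed_moment_def monomial_def)
  have "mixed_moment I Z (\<lambda>_. 0) (c # w) = wconv (pairing ?C c) (mixed_moment I Z (\<lambda>_. 0)) w" for c w
  proof -
    have p: "pairing ?C c = (\<lambda>u. \<Sum>\<alpha>\<in>I. of_real ((\<sigma> \<alpha>)\<^sup>2) * c \<alpha> * coord \<alpha> u)"
    proof
      fix u show "pairing ?C c u = (\<Sum>\<alpha>\<in>I. of_real ((\<sigma> \<alpha>)\<^sup>2) * c \<alpha> * coord \<alpha> u)"
        by (cases u; cases "tl u") (simp_all add: coord_def)
    qed
    have "mixed_moment I Z (\<lambda>_. 0) (c # w) =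
        (\<Sum>\<alpha>\<in>I. c \<alpha> * (of_real ((\<sigma> \<alpha>)\<^sup>2) * wconv (coord \<alpha>) (mixed_moment I Z (\<lambda>_. 0)) w))"
      unfolding mixed_moment_Cons[OF G]
      using mixed_moment_by_parts[OF G, of _ "\<lambda>_. 0" w] by (intro sum.cong refl) simp
    then show ?thesis
      unfolding p wconv_sum_left wconv_scale_left by (simp only: mult_ac)
  qed
  then show ?thesis
    unfolding wick_functional_def W by (simp add: mixed_moment_def monomial_def prob_space)
qed

end

section \<open>Spectral moments of Hermitian matrices\<close>

definition mat_trace :: "'a::comm_monoid_add mat \<Rightarrow> 'a" where
  "mat_trace A = (\<Sum>i<dim_row A. A $$ (i, i))"

lemma index_mult_mat_sum:
  assumes "A \<in> carrier_mat n n" "B \<in> carrier_mat n n" "i < n" "j < n"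
  shows "(A * B) $$ (i, j) = (\<Sum>k<n. A $$ (i, k) * B $$ (k, j))"
  using assms by (simp add: scalar_prod_def atLeast0LessThan)

lemma mat_trace_mult_commute:
  fixes A B :: "'a::comm_semiring_0 mat"
  assumes "A \<in> carrier_mat n n" "B \<in> carrier_mat n n"
  shows "mat_trace (A * B) = mat_trace (B * A)"
proof -
  have "mat_trace (A * B) = (\<Sum>i<n. \<Sum>k<n. A $$ (i, k) * B $$ (k, i))"
    using assms by (auto simp: mat_trace_def index_mult_mat_sum[OF assms] simp del: index_mult_mat(1) intro!: sum.cong)
  also have "\<dots> = (\<Sum>k<n. \<Sum>i<n. B $$ (k, i) * A $$ (i, k))"
    by (subst sum.swap) (simp add: mult.commute)
  also have "\<dots> = mat_trace (B * A)"
    using assms by (auto simp: mat_trace_def index_mult_mat_sum[OF assms(2,1)] simp del: index_mult_mat(1) intro!: sum.cong)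
  finally show ?thesis .
qed

lemma mat_trace_similar:
  assumes "A \<in> carrier_mat n n" "similar_mat_wit (A :: 'a::comm_ring_1 mat) B P Q"
  shows "mat_trace A = mat_trace B"
proof -
  note s = similar_mat_witD2[OF assms]
  have "mat_trace A = mat_trace (P * (B * Q))" using s by (simp add: assoc_mult_mat[of P n n B n Q n])
  also have "\<dots> = mat_trace (B * Q * P)" using s by (intro mat_trace_mult_commute) auto
  also have "B * Q * P = B" using s by (simp add: assoc_mult_mat[of B n n Q n P n])
  finally show ?thesis .
qed

lemma upper_triangular_pow:
  fixes B :: "'a::comm_ring_1 mat"
  assumes B: "B \<in> carrier_mat n n" "upper_triangular B"
  shows "upper_triangular (B ^\<^sub>m k) \<and> (\<forall>i<n. (B ^\<^sub>m k) $$ (i, i) = B $$ (i, i) ^ k)"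
proof (induction k)
  case 0
  then show ?case using B by simp
next
  case (Suc k)
  have C: "B ^\<^sub>m k \<in> carrier_mat n n" using B by simp
  have low: "(B ^\<^sub>m k) $$ (i, l) = 0" if "l < i" "i < n" for i l
    using Suc.IH C that by (auto intro: upper_triangularD)
  have lowB: "B $$ (i, l) = 0" if "l < i" "i < n" for i l
    using B that by (auto intro: upper_triangularD)
  have entry: "(B ^\<^sub>m Suc k) $$ (i, j) = (\<Sum>l<n. (B ^\<^sub>m k) $$ (i, l) * B $$ (l, j))" if "i < n" "j < n" for i j
    using index_mult_mat_sum[OF C B(1) that] by simp
  have "(B ^\<^sub>m Suc k) $$ (i, j) = 0" if "i < n" "j < i" for i j
  proof -
    have "(B ^\<^sub>m k) $$ (i, l) * B $$ (l, j) = 0" if "l < n" for l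
      using low[of l i] lowB[of j l] that \<open>i < n\<close> \<open>j < i\<close> by (cases "l < i") auto
    then show ?thesis using entry[of i j] that by (simp del: pow_mat.simps)
  qed
  moreover have "(B ^\<^sub>m Suc k) $$ (i, i) = B $$ (i, i) ^ Suc k" if "i < n" for i
  proof -
    have "(B ^\<^sub>m k) $$ (i, l) * B $$ (l, i) = (if l = i then B $$ (i, i) ^ Suc k else 0)" if "l < n" for l
      using low[of l i] lowB[of i l] that \<open>i < n\<close> Suc.IH by (cases "l < i"; cases "l = i") auto
    then show ?thesis using entry[of i i] that by (simp del: pow_mat.simps power_Suc)
  qed
  ultimately show ?case using B by (auto simp del: pow_mat.simps intro!: upper_triangularI)
qed

lemma pow_mat_eq_path_sum:
  fixes A :: "'a::comm_semiring_1 mat"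
  assumes A: "A \<in> carrier_mat d d" and "a < d" "b < d"
  shows "(A ^\<^sub>m k) $$ (a, b) = path_sum d k a b (\<lambda>w. \<Prod>x\<leftarrow>w. A $$ x)"
  using assms(2,3)
proof (induction k arbitrary: a)
  case 0
  then show ?case using A by simp
next
  case (Suc k)
  have C: "A ^\<^sub>m k \<in> carrier_mat d d" using A by simp
  have comm: "A ^\<^sub>m Suc k = A * A ^\<^sub>m k"
  proof (induction k)
    case (Suc k)
    have "A ^\<^sub>m Suc (Suc k) = (A * A ^\<^sub>m k) * A" by (simp only: pow_mat.simps(2)[of A "Suc k"] Suc)
    also have "\<dots> = A * (A ^\<^sub>m k * A)" using A by (intro assoc_mult_mat[of _ d d _ d _ d]) auto
    finally show ?case by simp
  qed (use A in simp)
  have "(A ^\<^sub>m Suc k) $$ (a, b) = (\<Sum>c<d. A $$ (a, c) * (A ^\<^sub>m k) $$ (c, b))"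
    unfolding comm by (rule index_mult_mat_sum[OF A C Suc.prems])
  also have "\<dots> = (\<Sum>c<d. A $$ (a, c) * path_sum d k c b (\<lambda>w. \<Prod>x\<leftarrow>w. A $$ x))"
    by (intro sum.cong refl) (simp add: Suc.IH Suc.prems)
  finally show ?case by (simp add: path_sum_scale)
qed

text \<open>Schur decomposition puts the roots, with multiplicity, on the diagonal of a triangular
  matrix; its powers carry the powers of the roots there, and the trace is invariant under
  similarity.\<close>

lemma sum_char_poly_roots_power:
  fixes A :: "complex mat"
  assumes A: "A \<in> carrier_mat d d"
  shows "(\<Sum>x\<in>#proots (char_poly A). x ^ k) = (\<Sum>a<d. path_sum d k a a (\<lambda>w. \<Prod>x\<leftarrow>w. A $$ x))"
    and "size (proots (char_poly A)) = d"
proof -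
  obtain es where es: "char_poly A = (\<Prod>e\<leftarrow>es. [:- e, 1:])" and len: "length es = d"
    using char_poly_factorized[OF A] by blast
  have roots: "proots (char_poly A) = mset es"
  proof -
    have "proots (\<Prod>e\<leftarrow>es. [:- e, 1:]) = mset es"
    proof (induction es)
      case (Cons a es)
      have "(\<Prod>e\<leftarrow>es. [:- e, 1:]) \<noteq> 0" by (induction es) (simp_all del: mult_pCons_left)
      then show ?case
        using Cons proots_mult[of "[:- a, 1:]" "\<Prod>e\<leftarrow>es. [:- e, 1:]"] by (simp del: mult_pCons_left)
    qed simp
    then show ?thesis by (simp add: es)
  qed
  then show "size (proots (char_poly A)) = d" by (simp add: len)
  obtain B P Q where dec: "schur_decomposition A es = (B, P, Q)"
    by (cases "schur_decomposition A es")
  from schur_decomposition[OF A es dec] have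
    sim: "similar_mat_wit A B P Q" and tri: "upper_triangular B" and diag: "diag_mat B = es" by auto
  have B: "B \<in> carrier_mat d d" using similar_mat_witD2[OF A sim] by blast
  have "(\<Sum>x\<in>#proots (char_poly A). x ^ k) = (\<Sum>x\<leftarrow>es. x ^ k)"
    by (simp add: roots sum_mset_sum_list flip: mset_map)
  also have "\<dots> = (\<Sum>i<d. B $$ (i, i) ^ k)"
    using B by (simp add: diag[symmetric] diag_mat_def o_def interv_sum_list_conv_sum_set_nat atLeast0LessThan)
  also have "\<dots> = mat_trace (B ^\<^sub>m k)"
    using upper_triangular_pow[OF B tri, of k] B by (simp add: mat_trace_def)
  also have "\<dots> = mat_trace (A ^\<^sub>m k)"
    using mat_trace_similar[of "A ^\<^sub>m k" d, OF _ similar_mat_wit_pow[OF sim]] A by simp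
  also have "\<dots> = (\<Sum>a<d. path_sum d k a a (\<lambda>w. \<Prod>x\<leftarrow>w. A $$ x))"
    using A by (simp add: mat_trace_def pow_mat_eq_path_sum[OF A])
  finally show "(\<Sum>x\<in>#proots (char_poly A). x ^ k) = \<dots>" .
qed

text \<open>For an eigenvector \<open>v\<close> the quadratic form of \<open>A\<close> at
  \<open>v\<close> equals \<open>e * N\<close> with \<open>N\<close> the squared norm, and both the
  form and \<open>N\<close> are real.\<close>

lemma hermitian_eigenvalue_real:
  fixes A :: "complex mat"
  assumes A: "A \<in> carrier_mat d d" and herm: "\<And>i j. i < d \<Longrightarrow> j < d \<Longrightarrow> A $$ (j, i) = cnj (A $$ (i, j))"
    and root: "poly (char_poly A) e = 0"
  shows "e \<in> \<real>"
proof -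
  obtain v where v: "v \<in> carrier_vec d" "v \<noteq> 0\<^sub>v d" "A *\<^sub>v v = e \<cdot>\<^sub>v v"
    using root eigenvalue_root_char_poly[OF A, of e] A by (auto simp: eigenvalue_def eigenvector_def)
  have Av: "(\<Sum>j<d. A $$ (i, j) * v $ j) = e * v $ i" if "i < d" for i
  proof -
    have "(A *\<^sub>v v) $ i = (\<Sum>j<d. A $$ (i, j) * v $ j)"
      using A v(1) that by (simp add: scalar_prod_def atLeast0LessThan)
    then show ?thesis using v that by simp
  qed
  define N where "N = (\<Sum>i<d. cnj (v $ i) * v $ i)"
  have "e * N = (\<Sum>i<d. cnj (v $ i) * (e * v $ i))"
    by (simp add: N_def sum_distrib_left mult_ac)
  also have "\<dots> = (\<Sum>i<d. cnj (v $ i) * (\<Sum>j<d. A $$ (i, j) * v $ j))"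
    by (intro sum.cong refl) (simp add: Av)
  also have "\<dots> = (\<Sum>i<d. \<Sum>j<d. cnj (v $ i) * A $$ (i, j) * v $ j)"
    by (simp add: sum_distrib_left mult.assoc)
  finally have "e * N = (\<Sum>i<d. \<Sum>j<d. cnj (v $ i) * A $$ (i, j) * v $ j)" .
  moreover have "cnj (\<Sum>i<d. \<Sum>j<d. cnj (v $ i) * A $$ (i, j) * v $ j) =
      (\<Sum>i<d. \<Sum>j<d. cnj (v $ i) * A $$ (i, j) * v $ j)"
    by (subst (2) sum.swap) (auto simp: mult_ac herm[symmetric] intro!: sum.cong)
  ultimately have "cnj (e * N) = e * N" by simp
  moreover have "cnj N = N" by (simp add: N_def mult.commute)
  moreover have "N \<noteq> 0"
  proof
    assume "N = 0"
    moreover have "N = of_real (\<Sum>i<d. (cmod (v $ i))\<^sup>2)"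
      unfolding N_def of_real_sum by (intro sum.cong refl) (simp only: complex_norm_square mult.commute)
    ultimately have "(\<Sum>i<d. (cmod (v $ i))\<^sup>2) = 0" by (simp only: of_real_eq_0_iff)
    then have "\<forall>i<d. v $ i = 0" by (subst (asm) sum_nonneg_eq_0_iff) auto
    then show False using v(1,2) by (metis carrier_vecD eq_vecI index_zero_vec(1) index_zero_vec(2))
  qed
  ultimately have "cnj e = e" by simp
  then show ?thesis by (simp add: Reals_cnj_iff)
qed

lemma sum_mset_eq_sum_count:
  fixes f :: "'a \<Rightarrow> real"
  shows "(\<Sum>x\<in>#R. f x) = (\<Sum>x\<in>set_mset R. f x * real (count R x))"
proof -
  have "(\<Sum>x\<in>#R. f x) = (\<Sum>x\<in>S. f x * real (count R x))" if "finite S" "set_mset R \<subseteq> S" for S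
    using that(2)
  proof (induction R)
    case (add a R)
    have "f x * real (count (add_mset a R) x) = (if x = a then f x else 0) + f x * real (count R x)" for x
      by (simp add: algebra_simps)
    then show ?case using add that(1) by (simp add: sum.distrib)
  qed simp
  then show ?thesis by blast
qed

lemma integral_empirical:
  fixes f :: "real \<Rightarrow> real"
  assumes A: "A \<in> carrier_mat d d" and d: "d \<ge> 1" and f[measurable]: "f \<in> borel_measurable borel"
  shows "(\<integral>t. f t \<partial>empirical_eigenvalue_distr A) = (\<Sum>x\<in>#proots (char_poly A). f (Re x)) / real d"
    and "integrable (empirical_eigenvalue_distr A) f"
proof -
  let ?R = "proots (char_poly A)"
  have ne: "?R \<noteq> {#}" using sum_char_poly_roots_power(2)[OF A] d by auto
  have fin: "finite (set_pmf (pmf_of_multiset ?R))" by (simp add: set_pmf_of_multiset[OF ne])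
  show "integrable (empirical_eigenvalue_distr A) f"
    unfolding empirical_eigenvalue_distr_def
    by (subst integrable_distr_eq) (simp_all add: integrable_measure_pmf_finite[OF fin])
  have "(\<integral>t. f t \<partial>empirical_eigenvalue_distr A) = (\<integral>x. f (Re x) \<partial>measure_pmf (pmf_of_multiset ?R))"
    unfolding empirical_eigenvalue_distr_def by (subst integral_distr) simp_all
  also have "\<dots> = (\<Sum>x\<in>set_mset ?R. f (Re x) * (count ?R x / size ?R))"
    by (subst integral_measure_pmf_real[of "set_mset ?R"]) (simp_all add: pmf_of_multiset[OF ne] set_pmf_of_multiset[OF ne])
  also have "\<dots> = (\<Sum>x\<in>#?R. f (Re x)) / real d"
    by (simp add: sum_mset_eq_sum_count sum_char_poly_roots_power(2)[OF A] sum_divide_distrib)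
  finally show "(\<integral>t. f t \<partial>empirical_eigenvalue_distr A) = (\<Sum>x\<in>#?R. f (Re x)) / real d" .
qed

lemma real_distribution_empirical: "real_distribution (empirical_eigenvalue_distr A)"
  unfolding empirical_eigenvalue_distr_def
  by (intro prob_space.real_distribution_distr measure_pmf.prob_space_axioms) simp

lemma empirical_moment:
  assumes A: "A \<in> carrier_mat d d" and d: "d \<ge> 1"
    and herm: "\<And>i j. i < d \<Longrightarrow> j < d \<Longrightarrow> A $$ (j, i) = cnj (A $$ (i, j))"
  shows "complex_of_real (\<integral>t. t ^ k \<partial>empirical_eigenvalue_distr A) =
    1 / of_nat d * (\<Sum>a<d. path_sum d k a a (\<lambda>w. \<Prod>x\<leftarrow>w. A $$ x))"
proof -
  let ?R = "proots (char_poly A)"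
  have "char_poly A \<noteq> 0" using degree_monic_char_poly[OF A] by auto
  then have real: "of_real (Re x) = x" if "x \<in># ?R" for x
    using that hermitian_eigenvalue_real[OF A herm] by simp
  have "complex_of_real (\<Sum>x\<in>#?R. Re x ^ k) = (\<Sum>x\<in>#?R. x ^ k)"
  proof -
    have "complex_of_real (\<Sum>x\<in>#R. Re x ^ k) = (\<Sum>x\<in>#R. of_real (Re x) ^ k)" for R
      by (induction R) simp_all
    also have "(\<Sum>x\<in>#?R. of_real (Re x) ^ k) = (\<Sum>x\<in>#?R. x ^ k)"
      by (intro arg_cong[where f = sum_mset] image_mset_cong) (simp add: real)
    finally show ?thesis .
  qed
  then show ?thesis
    by (simp add: integral_empirical(1)[OF A d] sum_char_poly_roots_power(1)[OF A])
qed

section \<open>Empirical eigenvalue distributions as a kernel\<close>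

text \<open>Functions \<open>f\<close> with measurable \<open>\<omega> \<mapsto> \<integral> f d\<mu>\<^sub>\<omega>\<close> are closed under pointwise limits because the
  measures are finitely supported; by Weierstrass they include everything from polynomials up to
  the indicators of half-lines.\<close>

lemma ex_polynomials_tendsto_indicator:
  fixes x :: real
  obtains p :: "nat \<Rightarrow> real \<Rightarrow> real"
  where "\<And>n. real_polynomial_function (p n)" "\<And>t. (\<lambda>n. p n t) \<longlonglongrightarrow> indicator {..x} t"
proof -
  \<comment> \<open>For positive \<open>n\<close> this is the ramp that falls from 1 at
    \<open>x\<close> to 0 at \<open>x + 1 / n\<close>. It is approximated on windows that grow with
    \<open>n\<close>, so every \<open>t\<close> is eventually inside.\<close>
  define f where "f n t = max 0 (min 1 (1 - real n * (t - x)))" for n :: nat and t :: real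
  have "\<exists>p. real_polynomial_function p \<and> (\<forall>t\<in>{- real n..real n}. \<bar>f n t - p t\<bar> < 1 / real (Suc n))" for n
  proof -
    have "continuous_on {- real n..real n} (f n)"
      unfolding f_def by (intro continuous_intros)
    then show ?thesis
      using Stone_Weierstrass_real_polynomial_function[of "{- real n..real n}" "f n" "1 / real (Suc n)"]
      by (metis compact_Icc of_nat_0_less_iff zero_less_Suc zero_less_divide_1_iff)
  qed
  then obtain p where p: "\<And>n. real_polynomial_function (p n)"
    "\<And>n t. t \<in> {- real n..real n} \<Longrightarrow> \<bar>f n t - p n t\<bar> < 1 / real (Suc n)"
    by metis
  have "(\<lambda>n. p n t) \<longlonglongrightarrow> indicator {..x} t" for t
  proof -
    have f: "(\<lambda>n. f n t) \<longlonglongrightarrow> indicator {..x} t"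
    proof (cases "t \<le> x")
      case True
      then have "f n t = 1" for n by (simp add: f_def mult_nonneg_nonpos)
      then show ?thesis using True by simp
    next
      case False
      have "\<forall>\<^sub>F n in sequentially. real n \<ge> 1 / (t - x)"
        using filterlim_real_sequentially by (simp add: filterlim_at_top)
      then have "\<forall>\<^sub>F n in sequentially. f n t = 0"
      proof eventually_elim
        case (elim n)
        then have "1 \<le> real n * (t - x)" using False by (simp add: field_simps)
        then show ?case by (simp add: f_def)
      qed
      then show ?thesis using False by (simp add: tendsto_eventually)
    qed
    have "(\<lambda>n. f n t - p n t) \<longlonglongrightarrow> 0"
    proof (rule Lim_null_comparison)
      have "\<forall>\<^sub>F n in sequentially. real n \<ge> \<bar>t\<bar>"
        using filterlim_real_sequentially by (simp add: filterlim_at_top)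
      then show "\<forall>\<^sub>F n in sequentially. norm (f n t - p n t) \<le> 1 / real (Suc n)"
      proof eventually_elim
        case (elim n)
        then have "t \<in> {- real n..real n}" by auto
        then show ?case using p(2)[of t n] by simp
      qed
      show "(\<lambda>n. 1 / real (Suc n)) \<longlonglongrightarrow> 0" by (rule LIMSEQ_inverse_real_of_nat[unfolded inverse_eq_divide])
    qed
    from tendsto_diff[OF f this] show ?thesis by simp
  qed
  with p(1) show ?thesis using that by blast
qed

lemma tendsto_sum_mset:
  fixes f :: "nat \<Rightarrow> 'a \<Rightarrow> real"
  assumes "\<And>x. x \<in># R \<Longrightarrow> (\<lambda>n. f n x) \<longlonglongrightarrow> g x"
  shows "(\<lambda>n. \<Sum>x\<in>#R. f n x) \<longlonglongrightarrow> (\<Sum>x\<in>#R. g x)"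
  using assms by (induction R) (auto intro!: tendsto_add)

text \<open>No measurable choice of eigenvalues is made: the moments, which for the random matrix
  are polynomials in its entries, give all polynomials, and these give the half-lines, an
  intersection-stable generator.\<close>

lemma empirical_measurable:
  assumes d: "d \<ge> 1" and A: "\<And>\<omega>. \<omega> \<in> space P \<Longrightarrow> A \<omega> \<in> carrier_mat d d"
    and mom: "\<And>k. (\<lambda>\<omega>. \<integral>t. t ^ k \<partial>empirical_eigenvalue_distr (A \<omega>)) \<in> borel_measurable P"
  shows "(\<lambda>\<omega>. empirical_eigenvalue_distr (A \<omega>)) \<in> P \<rightarrow>\<^sub>M prob_algebra borel"
proof (rule measurable_prob_algebra_generated[where \<Omega> = UNIV and G = "range (\<lambda>x :: real. {..x})"])
  show "sets borel = sigma_sets UNIV (range (\<lambda>x :: real. {..x}))"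
    by (subst borel_eq_atMost) simp
  show "Int_stable (range (\<lambda>x :: real. {..x}))"
    by (auto simp: Int_stable_def)
  show "range (\<lambda>x :: real. {..x}) \<subseteq> Pow UNIV" by simp
  fix \<omega> assume "\<omega> \<in> space P"
  interpret real_distribution "empirical_eigenvalue_distr (A \<omega>)"
    by (rule real_distribution_empirical)
  show "prob_space (empirical_eigenvalue_distr (A \<omega>))" by unfold_locales
  show "sets (empirical_eigenvalue_distr (A \<omega>)) = sets borel" by simp
next
  let ?E = "\<lambda>\<omega>. empirical_eigenvalue_distr (A \<omega>)"
  fix B assume "B \<in> range (\<lambda>x :: real. {..x})"
  then obtain x where B: "B = {..x}" by blast
  obtain p where p: "\<And>n. real_polynomial_function (p n)" "\<And>t. (\<lambda>n. p n t) \<longlonglongrightarrow> indicator {..x} t"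
    using ex_polynomials_tendsto_indicator by blast
  have pm: "p n \<in> borel_measurable borel" for n
    using p(1)[of n] by (simp add: borel_measurable_continuous_onI real_polynomial_function_eq
        continuous_on_polymonial_function)
  have "(\<lambda>\<omega>. \<integral>t. p n t \<partial>?E \<omega>) \<in> borel_measurable P" for n
  proof -
    obtain a N where pn: "p n = (\<lambda>t. \<Sum>i\<le>N. a i * t ^ i)"
      using p(1)[of n] real_polynomial_function_iff_sum by blast
    have "(\<integral>t. p n t \<partial>?E \<omega>) = (\<Sum>i\<le>N. a i * (\<integral>t. t ^ i \<partial>?E \<omega>))" if "\<omega> \<in> space P" for \<omega>
    proof -
      have "integrable (?E \<omega>) (\<lambda>t. a i * t ^ i)" for i
        by (rule integral_empirical(2)[OF A[OF that] d]) simp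
      then show ?thesis
        unfolding pn by (simp add: Bochner_Integration.integral_sum)
    qed
    moreover have "(\<lambda>\<omega>. \<Sum>i\<le>N. a i * (\<integral>t. t ^ i \<partial>?E \<omega>)) \<in> borel_measurable P"
      using mom by measurable
    ultimately show ?thesis by (simp cong: measurable_cong)
  qed
  moreover have "(\<lambda>n. \<integral>t. p n t \<partial>?E \<omega>) \<longlonglongrightarrow> measure (?E \<omega>) B" if "\<omega> \<in> space P" for \<omega>
  proof -
    interpret real_distribution "?E \<omega>" by (rule real_distribution_empirical)
    have "measure (?E \<omega>) B = (\<integral>t. indicator {..x} t \<partial>?E \<omega>)" by (simp add: B)
    also have "\<dots> = (\<Sum>y\<in>#proots (char_poly (A \<omega>)). indicator {..x} (Re y)) / real d"
      by (rule integral_empirical(1)[OF A[OF that] d]) simp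
    finally have eq: "measure (?E \<omega>) B = \<dots>" .
    show ?thesis
      unfolding integral_empirical(1)[OF A[OF that] d pm] eq
      by (intro tendsto_divide tendsto_sum_mset p(2) tendsto_const) (use d in simp)
  qed
  ultimately have "(\<lambda>\<omega>. measure (?E \<omega>) B) \<in> borel_measurable P"
    by (rule borel_measurable_LIMSEQ_real[rotated])
  then have "(\<lambda>\<omega>. ennreal (measure (?E \<omega>) B)) \<in> borel_measurable P" by measurable
  moreover have "emeasure (?E \<omega>) B = ennreal (measure (?E \<omega>) B)" for \<omega>
  proof -
    interpret real_distribution "?E \<omega>" by (rule real_distribution_empirical)
    show ?thesis by (rule emeasure_eq_measure)
  qed
  ultimately show "(\<lambda>\<omega>. emeasure (?E \<omega>) B) \<in> borel_measurable P" by simp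
qed

text \<open>Integration against a mixture is an iterated integral for bounded real functions. The
  complex exponential is therefore split into cosine and sine.\<close>

lemma (in prob_space) char_bind:
  assumes K: "K \<in> M \<rightarrow>\<^sub>M prob_algebra borel"
  shows "char (M \<bind> K) t = (\<integral>\<omega>. char (K \<omega>) t \<partial>M)"
    and "(\<lambda>\<omega>. char (K \<omega>) t) \<in> borel_measurable M"
    and "real_distribution (M \<bind> K)"
proof -
  have K': "K \<in> M \<rightarrow>\<^sub>M subprob_algebra borel" using K by (rule measurable_prob_algebraD)
  have prob: "prob_space (K \<omega>)" "sets (K \<omega>) = sets borel" if "\<omega> \<in> space M" for \<omega>
    using measurable_space[OF K that] by (auto simp: space_prob_algebra)
  have rd: "real_distribution (K \<omega>)" if "\<omega> \<in> space M" for \<omega>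
    using prob[OF that] by (simp add: real_distribution_def real_distribution_axioms_def)
  show B: "real_distribution (M \<bind> K)"
    using prob_space_bind[OF _ K'] sets_bind[OF prob(2) not_empty] prob(1)
    by (auto simp: real_distribution_def real_distribution_axioms_def)
  have int: "(\<integral>t. f t \<partial>(M \<bind> K)) = (\<integral>\<omega>. \<integral>t. f t \<partial>K \<omega> \<partial>M)"
    and meas: "(\<lambda>\<omega>. \<integral>t. f t \<partial>K \<omega>) \<in> borel_measurable M"
    if [measurable]: "f \<in> borel_measurable borel" and bd: "\<And>t. \<bar>f t\<bar> \<le> 1" for f :: "real \<Rightarrow> real"
  proof -
    have m: "(\<lambda>N. \<integral>t. f t \<partial>N) \<in> borel_measurable (subprob_algebra borel)"
      by (rule integral_measurable_subprob_algebra) simp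
    from measurable_compose[OF K' this] show "(\<lambda>\<omega>. \<integral>t. f t \<partial>K \<omega>) \<in> borel_measurable M" .
    have "(\<integral>t. f t \<partial>(M \<bind> K)) = (\<integral>N. \<integral>t. f t \<partial>N \<partial>distr M (subprob_algebra borel) K)"
      unfolding bind_nonempty''[OF K' not_empty]
    proof (rule integral_join[where B = 1 and B' = 1])
      show "finite_measure (distr M (subprob_algebra borel) K)"
        by (rule finite_measure_distr[OF K'])
      show "AE N in distr M (subprob_algebra borel) K. emeasure N (space N) \<le> ennreal 1"
        by (rule AE_I2) (auto simp: space_subprob_algebra subprob_space.subprob_emeasure_le_1)
    qed (use bd in auto)
    also have "\<dots> = (\<integral>\<omega>. \<integral>t. f t \<partial>K \<omega> \<partial>M)"
      by (rule integral_distr[OF K' m])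
    finally show "(\<integral>t. f t \<partial>(M \<bind> K)) = (\<integral>\<omega>. \<integral>t. f t \<partial>K \<omega> \<partial>M)" .
  qed
  have eq: "char N t = Complex (\<integral>x. cos (t * x) \<partial>N) (\<integral>x. sin (t * x) \<partial>N)" if "real_distribution N" for N
  proof -
    interpret N: real_distribution N by fact
    have i: "integrable N (\<lambda>x. iexp (t * x))" by (rule N.integrable_iexp) simp_all
    have "Re (iexp y) = cos y" "Im (iexp y) = sin y" for y
      by (simp_all add: Re_exp Im_exp)
    then show ?thesis
      unfolding char_def complex_eq_iff complex.sel
      using integral_Re[OF i] integral_Im[OF i] by (simp only:)
  qed
  let ?c = "\<lambda>\<omega>. \<integral>x. cos (t * x) \<partial>K \<omega>" and ?s = "\<lambda>\<omega>. \<integral>x. sin (t * x) \<partial>K \<omega>"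
  have cm: "?c \<in> borel_measurable M" "?s \<in> borel_measurable M"
    by (intro meas; simp)+
  have "(\<lambda>\<omega>. complex_of_real (?c \<omega>) + \<i> * of_real (?s \<omega>)) \<in> borel_measurable M"
    using cm by measurable
  moreover have charK: "char (K \<omega>) t = of_real (?c \<omega>) + \<i> * of_real (?s \<omega>)" if "\<omega> \<in> space M" for \<omega>
    by (simp add: eq[OF rd[OF that]] complex_eq_iff)
  ultimately show cmeas: "(\<lambda>\<omega>. char (K \<omega>) t) \<in> borel_measurable M" by (simp cong: measurable_cong)
  have ci: "integrable M (\<lambda>\<omega>. char (K \<omega>) t)"
    by (rule integrable_const_bound[where B = 1])
       (use real_distribution.cmod_char_le_1[OF rd] cmeas in auto)
  show "char (M \<bind> K) t = (\<integral>\<omega>. char (K \<omega>) t \<partial>M)"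
  proof (rule complex_eqI)
    have "Re (\<integral>\<omega>. char (K \<omega>) t \<partial>M) = (\<integral>\<omega>. ?c \<omega> \<partial>M)"
      unfolding integral_Re[OF ci, symmetric] by (intro Bochner_Integration.integral_cong) (simp_all add: eq[OF rd])
    then show "Re (char (M \<bind> K) t) = Re (\<integral>\<omega>. char (K \<omega>) t \<partial>M)"
      by (simp add: eq[OF B] int)
    have "Im (\<integral>\<omega>. char (K \<omega>) t \<partial>M) = (\<integral>\<omega>. ?s \<omega> \<partial>M)"
      unfolding integral_Im[OF ci, symmetric] by (intro Bochner_Integration.integral_cong) (simp_all add: eq[OF rd])
    then show "Im (char (M \<bind> K) t) = Im (\<integral>\<omega>. char (K \<omega>) t \<partial>M)"
      by (simp add: eq[OF B] int)
  qed
qed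

section \<open>Properties of Wick functionals\<close>

lemma wconv_cong:
  assumes "w \<in> lists A" "\<And>u. u \<in> lists A \<Longrightarrow> f u = f' u"
  shows "wconv f g w = wconv f' g w"
  using assms
proof (induction w arbitrary: f f' g rule: list.induct)
  case (Cons x w)
  have x: "x \<in> A" and w: "w \<in> lists A" using Cons.prems(1) by auto
  have "wconv (\<lambda>u. f (x # u)) g w = wconv (\<lambda>u. f' (x # u)) g w"
    by (rule Cons.IH[OF w]) (use Cons.prems(2) x in simp)
  moreover have "wconv f (\<lambda>v. g (x # v)) w = wconv f' (\<lambda>v. g (x # v)) w"
    by (rule Cons.IH[OF w Cons.prems(2)])
  ultimately show ?case by simp
qed simp

lemma wconv_map: "wconv f g (map \<phi> w) = wconv (\<lambda>u. f (map \<phi> u)) (\<lambda>v. g (map \<phi> v)) w"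
  by (induction w arbitrary: f g) simp_all

lemma pairing_Cons: "(\<lambda>u. pairing C x (y # u)) = (\<lambda>u. C x y * wone u)"
proof
  fix u show "pairing C x (y # u) = C x y * wone u"
    by (cases u) (simp_all add: wone_def)
qed

lemma wick_functional_cong:
  assumes W: "wick_functional A C W" and C: "\<And>x y. x \<in> A \<Longrightarrow> y \<in> A \<Longrightarrow> C x y = C' x y"
  shows "wick_functional A C' W"
proof -
  have "pairing C x u = pairing C' x u" if "x \<in> A" "u \<in> lists A" for x u
    using that C by (cases u; cases "tl u") auto
  then have "wconv (pairing C x) W w = wconv (pairing C' x) W w" if "x \<in> A" "w \<in> lists A" for x w
    using that by (intro wconv_cong[OF that(2)]) auto
  then show ?thesis using W by (simp add: wick_functional_def)
qed

lemma wick_functional_map: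
  assumes "wick_functional UNIV C W"
  shows "wick_functional UNIV (\<lambda>x y. C (\<phi> x) (\<phi> y)) (\<lambda>w. W (map \<phi> w))"
proof -
  have "pairing C (\<phi> x) (map \<phi> u) = pairing (\<lambda>x y. C (\<phi> x) (\<phi> y)) x u" for x u
    by (cases u; cases "tl u") auto
  then show ?thesis
    using assms by (simp add: wick_functional_def wconv_map)
qed

text \<open>Each letter of \<open>w\<close> is a possible partner of \<open>x\<close>, and removing
  it leaves a word that is shorter by one.\<close>

lemma norm_wconv_pairing_le:
  assumes "w \<in> lists A" "\<And>y. y \<in> A \<Longrightarrow> norm (C x y) \<le> 1" "B \<ge> 0"
    and "\<And>v. v \<in> lists A \<Longrightarrow> length v = length w - 1 \<Longrightarrow> norm (F v) \<le> B"
  shows "norm (wconv (pairing C x) F w) \<le> real (length w) * B"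
  using assms
proof (induction w arbitrary: F rule: list.induct)
  case (Cons y w)
  have y: "y \<in> A" and w: "w \<in> lists A" using Cons.prems(1) by auto
  have "norm (C x y * F w) \<le> 1 * B"
    unfolding norm_mult using Cons.prems y w by (intro mult_mono) auto
  moreover have "norm (wconv (pairing C x) (\<lambda>v. F (y # v)) w) \<le> real (length w) * B"
  \<comment> \<open>For an empty \<open>w\<close> the truncated length would refer to the wrong
    words, but then no partner is left and the term vanishes.\<close>
  proof (cases "w = []")
    case False
    then show ?thesis
      using Cons.prems(2-4) y by (intro Cons.IH[OF w]) auto
  qed simp
  ultimately have "norm (C x y * F w + wconv (pairing C x) (\<lambda>v. F (y # v)) w) \<le> 1 * B + real (length w) * B"
    by (rule norm_triangle_mono)
  moreover have "1 * B + real (length w) * B = real (length (y # w)) * B"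
    by (simp add: distrib_right)
  ultimately show ?case
    by (simp only: wconv.simps pairing_Cons wconv_scale_left wconv_wone_left)
qed simp

lemma normal_moment_1_nonneg: "normal_moment 1 k \<ge> 0"
proof (induction k rule: less_induct)
  case (less k)
  show ?case
  proof (cases k)
    case (Suc j)
    then show ?thesis using less[of "j - 1"] by (cases j) (simp_all add: normal_moment_Suc)
  qed (simp add: normal_moment_0)
qed

text \<open>When all covariances have modulus at most 1, Wick's recursion is dominated by the
  recursion for the moments of a standard normal variable.\<close>

lemma norm_wick_functional_le:
  assumes W: "wick_functional A C W" and C: "\<And>x y. x \<in> A \<Longrightarrow> y \<in> A \<Longrightarrow> norm (C x y) \<le> 1"
    and w: "w \<in> lists A"
  shows "norm (W w) \<le> normal_moment 1 (length w)"
  using w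
proof (induction w rule: length_induct)
  case (1 w)
  show ?case
  proof (cases w)
    case Nil
    then show ?thesis using W by (simp add: wick_functional_def normal_moment_0)
  next
    case (Cons x w')
    then have x: "x \<in> A" and w': "w' \<in> lists A" using 1(2) by auto
    have "norm (wconv (pairing C x) W w') \<le> real (length w') * normal_moment 1 (length w' - 1)"
    proof (rule norm_wconv_pairing_le[OF w'])
      fix v assume "v \<in> lists A" "length v = length w' - 1"
      then show "norm (W v) \<le> normal_moment 1 (length w' - 1)"
        using 1(1) Cons by (metis diff_le_self le_imp_less_Suc length_Cons)
    qed (use C x normal_moment_1_nonneg in auto)
    then show ?thesis
      using W x w' by (simp add: Cons wick_functional_def normal_moment_Suc)
  qed
qed

section \<open>Splitting off an uncorrelated Gaussian variable\<close>

lemma wconv_pairing_replicate: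
  assumes "\<And>y. y \<in> set v \<Longrightarrow> C g y = 0"
  shows "wconv (pairing C g) F (replicate l g @ v) = of_nat l * C g g * F (replicate (l - 1) g @ v)"
proof (induction l arbitrary: F)
  case 0
  have "pairing C g u = 0" if "u \<in> lists (set v)" for u
    using that assms by (cases u; cases "tl u") auto
  then have "wconv (pairing C g) F v = wconv (\<lambda>u. 0) F v"
    by (intro wconv_cong[of _ "set v"]) auto
  then show ?case by (simp add: wconv_zero_left)
next
  case (Suc l)
  have "g # replicate (l - 1) g = replicate l g" if "l > 0"
    using that by (cases l) auto
  then have "of_nat l * C g g * F (g # (replicate (l - 1) g @ v)) = of_nat l * C g g * F (replicate l g @ v)"
    by (cases "l > 0") (auto simp flip: append_Cons)
  then have "wconv (pairing C g) F (g # (replicate l g @ v)) =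
      C g g * F (replicate l g @ v) + of_nat l * C g g * F (replicate l g @ v)"
    by (simp only: wconv.simps pairing_Cons wconv_scale_left wconv_wone_left Suc.IH)
  then show ?case by (simp add: distrib_right)
qed

text \<open>Uncorrelated jointly Gaussian variables are independent, in terms of moments: a letter
  \<open>g\<close> can only be paired with another \<open>g\<close>. This turns the trace of the GUE
  matrix into a separate normal factor.\<close>

lemma wick_functional_replicate:
  assumes W: "wick_functional UNIV C W" and v: "\<And>y. y \<in> set v \<Longrightarrow> C g y = 0"
    and g: "C g g = of_real (\<sigma>\<^sup>2)" "\<sigma> > 0"
  shows "W (replicate l g @ v) = of_real (normal_moment \<sigma> l) * W v"
proof (induction l rule: less_induct)
  case (less l)
  show ?case
  proof (cases l)
    case (Suc k)
    have "W (replicate l g @ v) = wconv (pairing C g) W (replicate k g @ v)"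
      using W by (simp add: Suc wick_functional_def)
    also have "\<dots> = of_nat k * C g g * W (replicate (k - 1) g @ v)"
      by (rule wconv_pairing_replicate) (rule v)
    also have "W (replicate (k - 1) g @ v) = of_real (normal_moment \<sigma> (k - 1)) * W v"
      by (rule less) (simp add: Suc)
    finally show ?thesis by (simp add: Suc normal_moment_Suc g mult_ac)
  qed (simp add: normal_moment_0 g)
qed

lemma sum_binomial_Suc:
  fixes T :: "nat \<Rightarrow> 'a::comm_semiring_1"
  shows "(\<Sum>j\<le>k. of_nat (k choose j) * g ^ (k - j) * T (Suc j)) + g * (\<Sum>j\<le>k. of_nat (k choose j) * g ^ (k - j) * T j)
    = (\<Sum>j\<le>Suc k. of_nat (Suc k choose j) * g ^ (Suc k - j) * T j)"
proof -
  have "g * (\<Sum>j\<le>k. of_nat (k choose j) * g ^ (k - j) * T j) =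
      (\<Sum>j\<le>k. of_nat (k choose j) * g ^ (Suc k - j) * T j)"
    unfolding sum_distrib_left by (intro sum.cong refl) (simp add: Suc_diff_le mult_ac)
  also have "\<dots> = (\<Sum>j\<le>Suc k. of_nat (k choose j) * g ^ (Suc k - j) * T j)"
    by (simp add: binomial_eq_0)
  also have "\<dots> = g ^ Suc k * T 0 + (\<Sum>j\<le>k. of_nat (k choose Suc j) * g ^ (k - j) * T (Suc j))"
    unfolding sum.atMost_Suc_shift by simp
  finally have "g * (\<Sum>j\<le>k. of_nat (k choose j) * g ^ (k - j) * T j) = \<dots>" .
  moreover have "(\<Sum>j\<le>Suc k. of_nat (Suc k choose j) * g ^ (Suc k - j) * T j) =
      g ^ Suc k * T 0 + (\<Sum>j\<le>k. of_nat (Suc k choose Suc j) * g ^ (k - j) * T (Suc j))"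
    unfolding sum.atMost_Suc_shift by simp
  ultimately show ?thesis by (simp add: distrib_right sum.distrib add_ac)
qed

text \<open>The binomial theorem for a matrix plus a scalar multiple \<open>g\<close> of the
  identity, which commutes with it; the induction step is Pascal's rule.\<close>

lemma path_sum_shift:
  fixes N :: "nat \<times> nat \<Rightarrow> 'a::comm_semiring_1"
  assumes "a < d"
  shows "path_sum d k a b (\<lambda>w. \<Prod>x\<leftarrow>w. N x + (if fst x = snd x then g else 0)) =
    (\<Sum>j\<le>k. of_nat (k choose j) * g ^ (k - j) * path_sum d j a b (\<lambda>w. \<Prod>x\<leftarrow>w. N x))"
  using assms
proof (induction k arbitrary: a)
  case (Suc k)
  let ?S = "\<lambda>k a. path_sum d k a b (\<lambda>w. \<Prod>x\<leftarrow>w. N x + (if fst x = snd x then g else 0))"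
  let ?T = "\<lambda>j a. path_sum d j a b (\<lambda>w. \<Prod>x\<leftarrow>w. N x)"
  have "?S (Suc k) a = (\<Sum>c<d. (N (a, c) + (if a = c then g else 0)) * ?S k c)"
    by (simp add: path_sum_scale)
  also have "\<dots> = (\<Sum>c<d. N (a, c) * ?S k c + (if a = c then g * ?S k c else 0))"
    by (intro sum.cong refl) (simp add: distrib_right)
  also have "\<dots> = (\<Sum>c<d. N (a, c) * ?S k c) + g * ?S k a"
    using Suc.prems by (simp add: sum.distrib)
  also have "(\<Sum>c<d. N (a, c) * ?S k c) =
      (\<Sum>c<d. \<Sum>j\<le>k. of_nat (k choose j) * g ^ (k - j) * (N (a, c) * ?T j c))"
    by (intro sum.cong refl) (simp add: Suc.IH sum_distrib_left mult_ac)
  also have "\<dots> = (\<Sum>j\<le>k. of_nat (k choose j) * g ^ (k - j) * ?T (Suc j) a)"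
    by (subst sum.swap) (simp add: path_sum_scale sum_distrib_left)
  also have "g * ?S k a = g * (\<Sum>j\<le>k. of_nat (k choose j) * g ^ (k - j) * ?T j a)"
    by (simp add: Suc)
  finally show ?case by (simp only: sum_binomial_Suc[of k g "\<lambda>j. ?T j a"])
qed simp

lemma norm_path_sum_le:
  fixes F :: "(nat \<times> nat) list \<Rightarrow> complex"
  assumes "a < d" "b < d" "B \<ge> 0"
    and "\<And>w. length w = k \<Longrightarrow> w \<in> lists ({..<d} \<times> {..<d}) \<Longrightarrow> norm (F w) \<le> B"
  shows "norm (path_sum d k a b F) \<le> real d ^ k * B"
  using assms
proof (induction k arbitrary: a F)
  case (Suc k)
  have "norm (path_sum d (Suc k) a b F) \<le> (\<Sum>c<d. real d ^ k * B)"
    unfolding path_sum.simps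
    by (intro sum_norm_le Suc.IH Suc.prems(4)) (use Suc.prems in auto)
  then show ?case by simp
qed auto

lemma integrable_path_sum:
  fixes F :: "(nat \<times> nat) list \<Rightarrow> 'w \<Rightarrow> complex"
  assumes "\<And>w. integrable M (F w)"
  shows "integrable M (\<lambda>\<omega>. path_sum d k a b (\<lambda>w. F w \<omega>))"
  using assms
proof (induction k arbitrary: a F)
  case 0
  then show ?case by (cases "a = b") auto
qed (auto intro!: Bochner_Integration.integrable_sum)

lemma integral_path_sum:
  fixes F :: "(nat \<times> nat) list \<Rightarrow> 'w \<Rightarrow> complex"
  assumes "\<And>w. integrable M (F w)"
  shows "(\<integral>\<omega>. path_sum d k a b (\<lambda>w. F w \<omega>) \<partial>M) = path_sum d k a b (\<lambda>w. \<integral>\<omega>. F w \<omega> \<partial>M)"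
  using assms
proof (induction k arbitrary: a F)
  case (Suc k)
  then show ?case
    by (simp add: Bochner_Integration.integral_sum integrable_path_sum)
qed simp

section \<open>Covariances of the GUE and of its traceless part\<close>

type_synonym gue_index = "(nat \<times> nat) + (nat \<times> nat)"

definition gue_indices :: "nat \<Rightarrow> gue_index set" where
  "gue_indices d = Inl ` {(i, j). i \<le> j \<and> j < d} \<union> Inr ` {(i, j). i < j \<and> j < d}"

fun gue_sd :: "nat \<Rightarrow> gue_index \<Rightarrow> real" where
  "gue_sd d (Inl (i, j)) = (if i = j then sqrt (1 / real d) else sqrt (1 / (2 * real d)))"
| "gue_sd d (Inr _) = sqrt (1 / (2 * real d))"

text \<open>The coefficients of an entry in the independent variables; \<open>min\<close> and
  \<open>max\<close> refer it to the upper triangle. On the diagonal the second clause is nonzero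
  only at an index outside \<open>gue_indices\<close>.\<close>

fun gue_coeff :: "nat \<times> nat \<Rightarrow> gue_index \<Rightarrow> complex" where
  "gue_coeff (a, b) (Inl p) = (if p = (min a b, max a b) then 1 else 0)"
| "gue_coeff (a, b) (Inr p) = (if p = (min a b, max a b) then if a < b then \<i> else - \<i> else 0)"

lemma finite_gue_indices [simp]: "finite (gue_indices d)"
proof -
  have "{(i, j). i \<le> j \<and> j < d} \<subseteq> {..<d} \<times> {..<d}" "{(i, j). i < j \<and> j < d} \<subseteq> {..<d} \<times> {..<d}"
    by auto
  then have "finite {(i, j). i \<le> j \<and> j < d}" "finite {(i, j). i < j \<and> j < d}"
    by (auto intro: finite_subset)
  then show ?thesis by (simp add: gue_indices_def)
qed

lemma sum_gue_indices:
  fixes f :: "gue_index \<Rightarrow> complex"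
  assumes "a < d" "b < d"
    and "\<And>p. p \<noteq> (min a b, max a b) \<Longrightarrow> f (Inl p) = 0"
    and "\<And>p. p \<noteq> (min a b, max a b) \<Longrightarrow> f (Inr p) = 0"
  shows "(\<Sum>\<alpha>\<in>gue_indices d. f \<alpha>) =
    f (Inl (min a b, max a b)) + (if a = b then 0 else f (Inr (min a b, max a b)))"
proof -
  let ?p = "(min a b, max a b)"
  let ?S = "insert (Inl ?p) (if a = b then {} else {Inr ?p})"
  have "?S \<subseteq> gue_indices d"
    using assms(1,2) by (auto simp: gue_indices_def min_def max_def)
  moreover have "f \<alpha> = 0" if "\<alpha> \<in> gue_indices d - ?S" for \<alpha>
    using that assms(3,4) by (cases \<alpha>) (auto simp: gue_indices_def split: if_splits)
  ultimately have "(\<Sum>\<alpha>\<in>gue_indices d. f \<alpha>) = (\<Sum>\<alpha>\<in>?S. f \<alpha>)"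
    by (intro sum.mono_neutral_right) auto
  also have "\<dots> = f (Inl ?p) + (if a = b then 0 else f (Inr ?p))"
    by simp
  finally show ?thesis .
qed

definition gue_cov :: "nat \<Rightarrow> (gue_index \<Rightarrow> complex) \<Rightarrow> (gue_index \<Rightarrow> complex) \<Rightarrow> complex" where
  "gue_cov d c e = (\<Sum>\<alpha>\<in>gue_indices d. of_real ((gue_sd d \<alpha>)\<^sup>2) * c \<alpha> * e \<alpha>)"

text \<open>The form is bilinear, without conjugation. For an off-diagonal entry taken with itself
  the real and imaginary parts contribute \<open>1 / (2 d)\<close> and \<open>- 1 / (2 d)\<close>;
  with its transpose they add up to \<open>1 / d\<close>.\<close>

lemma gue_cov_coeff:
  assumes "a < d" "b < d"
  shows "gue_cov d (gue_coeff (a, b)) (gue_coeff (e, f)) = (if a = f \<and> b = e then 1 / of_nat d else 0)"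
proof -
  have d: "d > 0" using assms by simp
  let ?f = "\<lambda>\<alpha>. of_real ((gue_sd d \<alpha>)\<^sup>2) * gue_coeff (a, b) \<alpha> * gue_coeff (e, f) \<alpha>"
  have "gue_cov d (gue_coeff (a, b)) (gue_coeff (e, f)) =
      ?f (Inl (min a b, max a b)) + (if a = b then 0 else ?f (Inr (min a b, max a b)))"
    unfolding gue_cov_def by (rule sum_gue_indices[OF assms]) simp_all
  also have "\<dots> = (if a = f \<and> b = e then 1 / of_nat d else 0)"
  proof (cases "(min a b, max a b) = (min e f, max e f)")
    case False
    then have "\<not> (a = f \<and> b = e)" by (metis min.commute max.commute)
    moreover have "gue_coeff (e, f) (Inl (min a b, max a b)) = 0" "gue_coeff (e, f) (Inr (min a b, max a b)) = 0"
      using False by (simp_all only: gue_coeff.simps if_False)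
    ultimately show ?thesis by (simp only: mult_zero_right if_False add_0 if_cancel)
  next
    case True
    then have "(e = a \<and> f = b) \<or> (e = b \<and> f = a)" by (auto simp: min_def max_def split: if_splits)
    then show ?thesis
      using d by (cases "a = b") (auto simp: power_divide min_def max_def simp flip: of_real_power)
  qed
  finally show ?thesis .
qed

lemma gue_cov_commute: "gue_cov d c e = gue_cov d e c"
  by (simp add: gue_cov_def mult_ac)

lemma gue_cov_diff_left: "gue_cov d (\<lambda>\<alpha>. c \<alpha> - c' \<alpha>) e = gue_cov d c e - gue_cov d c' e"
  by (simp add: gue_cov_def algebra_simps sum_subtractf)

lemma gue_cov_diff_right: "gue_cov d c (\<lambda>\<alpha>. e \<alpha> - e' \<alpha>) = gue_cov d c e - gue_cov d c e'"
  by (simp add: gue_cov_def algebra_simps sum_subtractf)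

lemma gue_cov_scale_left: "gue_cov d (\<lambda>\<alpha>. r * c \<alpha>) e = r * gue_cov d c e"
  by (simp add: gue_cov_def sum_distrib_left mult_ac)

lemma gue_cov_sum_left: "gue_cov d (\<lambda>\<alpha>. \<Sum>i\<in>I. c i \<alpha>) e = (\<Sum>i\<in>I. gue_cov d (c i) e)"
  unfolding gue_cov_def sum_distrib_left sum_distrib_right by (rule sum.swap)

definition gue_trace_form :: "nat \<Rightarrow> gue_index \<Rightarrow> complex" where
  "gue_trace_form d \<alpha> = 1 / of_nat d * (\<Sum>i<d. gue_coeff (i, i) \<alpha>)"

definition traceless_form :: "nat \<Rightarrow> nat \<times> nat \<Rightarrow> gue_index \<Rightarrow> complex" where
  "traceless_form d x \<alpha> = gue_coeff x \<alpha> - (if fst x = snd x then 1 else 0) * gue_trace_form d \<alpha>"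

lemma gue_cov_trace_coeff:
  assumes "a < d" "b < d"
  shows "gue_cov d (gue_trace_form d) (gue_coeff (a, b)) = (if a = b then 1 / (of_nat d)\<^sup>2 else 0)"
proof -
  have "gue_cov d (gue_trace_form d) (gue_coeff (a, b)) =
      1 / of_nat d * (\<Sum>i<d. gue_cov d (gue_coeff (i, i)) (gue_coeff (a, b)))"
    unfolding gue_trace_form_def[abs_def] gue_cov_scale_left gue_cov_sum_left ..
  also have "(\<Sum>i<d. gue_cov d (gue_coeff (i, i)) (gue_coeff (a, b))) =
      (\<Sum>i<d. if i = a then (if a = b then 1 / of_nat d else 0) else 0)"
    by (intro sum.cong refl) (auto simp: gue_cov_coeff)
  also have "\<dots> = (if a = b then 1 / of_nat d else 0)" using assms by simp
  finally show ?thesis by (simp add: power2_eq_square)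
qed

lemma gue_cov_trace_trace:
  assumes "d \<ge> 1"
  shows "gue_cov d (gue_trace_form d) (gue_trace_form d) = 1 / (of_nat d)\<^sup>2"
proof -
  have "gue_cov d (gue_trace_form d) (gue_trace_form d) =
      1 / of_nat d * (\<Sum>i<d. gue_cov d (gue_coeff (i, i)) (gue_trace_form d))"
    by (subst gue_trace_form_def[abs_def]) (simp only: gue_cov_scale_left gue_cov_sum_left)
  also have "(\<Sum>i<d. gue_cov d (gue_coeff (i, i)) (gue_trace_form d)) = (\<Sum>i<d. 1 / (of_nat d)\<^sup>2)"
    by (intro sum.cong refl) (simp add: gue_cov_commute[of d "gue_coeff _"] gue_cov_trace_coeff)
  finally show ?thesis using assms by simp
qed

lemma gue_cov_trace_traceless:
  assumes "a < d" "b < d"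
  shows "gue_cov d (gue_trace_form d) (traceless_form d (a, b)) = 0"
proof -
  have d: "d \<ge> 1" using assms by simp
  have "gue_cov d (gue_trace_form d) (traceless_form d (a, b)) =
      gue_cov d (gue_trace_form d) (gue_coeff (a, b)) -
      (if a = b then 1 else 0) * gue_cov d (gue_trace_form d) (gue_trace_form d)"
    unfolding traceless_form_def[abs_def] fst_conv snd_conv gue_cov_diff_right
    by (subst (2) gue_cov_commute) (simp only: gue_cov_scale_left)
  then show ?thesis by (simp add: gue_cov_trace_coeff[OF assms] gue_cov_trace_trace[OF d])
qed

text \<open>This is the value of \<open>site_trace_pair\<close>: the traceless GUE part has the
  covariance of a single site, which identifies the limit.\<close>

lemma gue_cov_traceless:
  assumes "a < d" "b < d" "e < d" "f < d"
  shows "gue_cov d (traceless_form d (a, b)) (traceless_form d (e, f)) = traceless_cov d (a, b) (e, f)"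
proof -
  have "gue_cov d (traceless_form d (a, b)) (traceless_form d (e, f)) =
      gue_cov d (gue_coeff (a, b)) (traceless_form d (e, f)) -
      (if a = b then 1 else 0) * gue_cov d (gue_trace_form d) (traceless_form d (e, f))"
    by (subst traceless_form_def[abs_def]) (simp only: fst_conv snd_conv gue_cov_diff_left gue_cov_scale_left)
  also have "gue_cov d (gue_coeff (a, b)) (traceless_form d (e, f)) =
      gue_cov d (gue_coeff (a, b)) (gue_coeff (e, f)) -
      (if e = f then 1 else 0) * gue_cov d (gue_trace_form d) (gue_coeff (a, b))"
    unfolding traceless_form_def[abs_def] fst_conv snd_conv gue_cov_diff_right
    by (subst (2) gue_cov_commute) (simp only: gue_cov_scale_left)
  finally show ?thesis
    using assms
    by (simp add: gue_cov_trace_traceless gue_cov_coeff gue_cov_trace_coeff traceless_cov_def)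
qed

context prob_space
begin

lemma linear_form_gue_coeff:
  assumes "a < d" "b < d"
  shows "linear_form (gue_indices d) Z (gue_coeff (a, b)) \<omega> = of_real (Z (Inl (min a b, max a b)) \<omega>) +
    (if a = b then 0 else if a < b then \<i> * of_real (Z (Inr (a, b)) \<omega>) else - \<i> * of_real (Z (Inr (b, a)) \<omega>))"
  unfolding linear_form_def
  by (subst sum_gue_indices[OF assms]) (auto simp: min_def max_def)

lemma linear_form_shift:
  "linear_form I Z (gue_coeff x) \<omega> = linear_form I Z (traceless_form d x) \<omega> +
    (if fst x = snd x then linear_form I Z (gue_trace_form d) \<omega> else 0)"
  by (cases "fst x = snd x") (simp_all add: linear_form_def traceless_form_def left_diff_distrib sum_subtractf)

end

section \<open>Limits of moments and moment determinacy\<close>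

lemma phi_s_seq_power_tendsto:
  assumes d: "d \<ge> 1" and W: "wick_functional ({..<d} \<times> {..<d}) (traceless_cov d) W"
  shows "(\<lambda>n. phi d (s_seq d n ^ k)) \<longlonglongrightarrow> 1 / of_nat d * (\<Sum>a<d. path_sum d k a a W)"
proof -
  let ?A = "{..<d} \<times> {..<d}"
  have W': "wick_functional ?A (\<lambda>x y. site_trace d [x, y]) W"
    using W by (rule wick_functional_cong) (auto simp: site_trace_pair)
  have lim: "(\<lambda>n. of_real (1 / sqrt (real n)) ^ k * wpow (site_trace d) n w) \<longlonglongrightarrow> W w"
    if "length w = k" "w \<in> lists ?A" for w
    using wpow_tendsto_wick_functional[OF site_trace_Nil[OF d] _ W' that(2)] that(1)
    by (auto simp: site_trace_single)
  have eq: "phi d (s_seq d n ^ k) = 1 / of_nat d *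
      (\<Sum>a<d. path_sum d k a a (\<lambda>w. of_real (1 / sqrt (real n)) ^ k * wpow (site_trace d) n w))" for n
    unfolding phi_s_seq_power[OF d] path_sum_scale sum_distrib_left[symmetric] by (simp only: mult_ac)
  show ?thesis
    unfolding eq by (intro tendsto_mult tendsto_const tendsto_sum tendsto_path_sum lim) auto
qed

lemma normal_distr_moment:
  assumes "\<sigma> > 0"
  shows "real_distribution (density lborel (normal_density 0 \<sigma>))"
    and "integrable (density lborel (normal_density 0 \<sigma>)) (\<lambda>t. t ^ k)"
    and "(\<integral>t. t ^ k \<partial>density lborel (normal_density 0 \<sigma>)) = normal_moment \<sigma> k"
proof -
  show "real_distribution (density lborel (normal_density 0 \<sigma>))"
    using prob_space_normal_density[OF assms, of 0]
    by (simp add: real_distribution_def real_distribution_axioms_def)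
  show "integrable (density lborel (normal_density 0 \<sigma>)) (\<lambda>t. t ^ k)"
    using integrable_normal_moment[OF assms, of 0 k] by (subst integrable_density) auto
  show "(\<integral>t. t ^ k \<partial>density lborel (normal_density 0 \<sigma>)) = normal_moment \<sigma> k"
    by (subst integral_density) (auto simp: normal_moment_def)
qed

lemma convolution_moment:
  assumes "real_distribution \<mu>" "real_distribution \<nu>"
    and \<mu>: "\<And>k. integrable \<mu> (\<lambda>t. t ^ k)" and \<nu>: "\<And>k. integrable \<nu> (\<lambda>t. t ^ k)"
  shows "real_distribution (\<mu> \<star> \<nu>)" "integrable (\<mu> \<star> \<nu>) (\<lambda>t. t ^ k)"
    "(\<integral>t. t ^ k \<partial>(\<mu> \<star> \<nu>)) =
      (\<Sum>j\<le>k. of_nat (k choose j) * (\<integral>t. t ^ (k - j) \<partial>\<nu>) * (\<integral>t. t ^ j \<partial>\<mu>))"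
proof -
  interpret \<mu>: real_distribution \<mu> by fact
  interpret \<nu>: real_distribution \<nu> by fact
  interpret pair_prob_space \<mu> \<nu> ..
  note [measurable_cong] = \<mu>.events_eq_borel \<nu>.events_eq_borel
  show "real_distribution (\<mu> \<star> \<nu>)"
    unfolding convolution_def by (rule real_distribution_distr) measurable
  have prod: "integrable (\<mu> \<Otimes>\<^sub>M \<nu>) (\<lambda>z. fst z ^ i * snd z ^ j)" for i j
  proof (rule Fubini_integrable)
    have "integrable \<mu> (\<lambda>x. \<bar>x ^ i\<bar> * (\<integral>y. \<bar>y ^ j\<bar> \<partial>\<nu>))"
      using \<mu>[of i] by (intro integrable_mult_left integrable_abs)
    then show "integrable \<mu> (\<lambda>x. \<integral>y. norm (fst (x, y) ^ i * snd (x, y) ^ j) \<partial>\<nu>)"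
      by (simp add: abs_mult)
    show "AE x in \<mu>. integrable \<nu> (\<lambda>y. fst (x, y) ^ i * snd (x, y) ^ j)"
      using \<nu>[of j] by simp
  qed measurable
  have prod_eq: "(\<integral>z. fst z ^ i * snd z ^ j \<partial>(\<mu> \<Otimes>\<^sub>M \<nu>)) = (\<integral>t. t ^ i \<partial>\<mu>) * (\<integral>t. t ^ j \<partial>\<nu>)" for i j
    using integral_fst'[OF prod[of i j]] by simp
  have pow: "(fst z + snd z) ^ k = (\<Sum>j\<le>k. of_nat (k choose j) * (fst z ^ j * snd z ^ (k - j)))" for z :: "real \<times> real"
    by (simp add: binomial_ring mult.assoc)
  have int: "integrable (\<mu> \<Otimes>\<^sub>M \<nu>) (\<lambda>z. (fst z + snd z) ^ k)"
    unfolding pow by (intro Bochner_Integration.integrable_sum integrable_mult_right prod)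
  have meas: "(\<lambda>z. fst z + snd z) \<in> borel_measurable (\<mu> \<Otimes>\<^sub>M \<nu>)" by measurable
  show "integrable (\<mu> \<star> \<nu>) (\<lambda>t. t ^ k)"
    unfolding convolution_def case_prod_unfold using int meas by (subst integrable_distr_eq) auto
  have "(\<integral>t. t ^ k \<partial>(\<mu> \<star> \<nu>)) = (\<integral>z. (fst z + snd z) ^ k \<partial>(\<mu> \<Otimes>\<^sub>M \<nu>))"
    unfolding convolution_def case_prod_unfold using meas by (subst integral_distr) auto
  also have "\<dots> = (\<Sum>j\<le>k. of_nat (k choose j) * ((\<integral>t. t ^ j \<partial>\<mu>) * (\<integral>t. t ^ (k - j) \<partial>\<nu>)))"
    unfolding pow using prod prod_eq by (simp add: Bochner_Integration.integral_sum)
  finally show "(\<integral>t. t ^ k \<partial>(\<mu> \<star> \<nu>)) =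
      (\<Sum>j\<le>k. of_nat (k choose j) * (\<integral>t. t ^ (k - j) \<partial>\<nu>) * (\<integral>t. t ^ j \<partial>\<mu>))"
    by (simp only: mult_ac)
qed

text \<open>Both characteristic functions are compared at the same \<open>t\<close> with one Taylor
  polynomial built from the common moments; \<open>growth\<close> makes the remainder
  vanish.\<close>

lemma (in prob_space) bind_eqI_moments:
  assumes K: "K \<in> M \<rightarrow>\<^sub>M prob_algebra borel"
    and K_int: "\<And>\<omega> k. \<omega> \<in> space M \<Longrightarrow> integrable (K \<omega>) (\<lambda>t. t ^ k)"
    and mom_int: "\<And>k. integrable M (\<lambda>\<omega>. \<integral>t. t ^ k \<partial>K \<omega>)"
    and \<mu>: "real_distribution \<mu>" "\<And>k. integrable \<mu> (\<lambda>t. t ^ k)"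
    and eq: "\<And>k. (\<integral>t. t ^ k \<partial>\<mu>) = (\<integral>\<omega>. \<integral>t. t ^ k \<partial>K \<omega> \<partial>M)"
    and growth: "\<And>t. (\<lambda>n. t ^ (2 * n) / fact (2 * n) * (\<integral>t. t ^ (2 * n) \<partial>\<mu>)) \<longlonglongrightarrow> 0"
  shows "\<mu> = M \<bind> K"
proof (rule Levy_uniqueness[OF \<mu>(1) char_bind(3)[OF K]], rule ext)
  fix t
  define m where "m k = (\<integral>t. t ^ k \<partial>\<mu>)" for k
  define T where "T n f = (\<Sum>k\<le>2 * n. (\<i> * complex_of_real t) ^ k / fact k * complex_of_real (f k))" for n and f :: "nat \<Rightarrow> real"
  \<comment> \<open>The order is even so that the absolute moment in the remainder is an ordinary
    moment.\<close>
  have approx: "cmod (char N t - T n (\<lambda>k. \<integral>x. x ^ k \<partial>N)) \<le> 2 * t ^ (2 * n) / fact (2 * n) * (\<integral>x. x ^ (2 * n) \<partial>N)"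
    if "real_distribution N" "\<And>k. integrable N (\<lambda>t. t ^ k)" for N n
    using real_distribution.char_approx1[OF that(1), of "2 * n" t] that(2)
    by (simp add: T_def power_even_abs)
  have rd: "real_distribution (K \<omega>)" if "\<omega> \<in> space M" for \<omega>
    using measurable_space[OF K that]
    by (auto simp: space_prob_algebra real_distribution_def real_distribution_axioms_def)
  define b where "b n = 2 * t ^ (2 * n) / fact (2 * n) * m (2 * n)" for n
  have a1: "cmod (char \<mu> t - T n m) \<le> b n" for n
    using approx[OF \<mu>] by (simp add: b_def m_def[abs_def])
  \<comment> \<open>The estimate is made for each \<open>K \<omega>\<close> and averaged afterwards:
    \<open>T n\<close> is linear in the moments, and the averaged moments are those of
    \<open>\<mu>\<close>.\<close>
  have a2: "cmod (char (M \<bind> K) t - T n m) \<le> b n" for n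
  proof -
    let ?m = "\<lambda>\<omega> k. \<integral>t. t ^ k \<partial>K \<omega>"
    have ci: "integrable M (\<lambda>\<omega>. char (K \<omega>) t)"
      by (rule integrable_const_bound[where B = 1])
         (use real_distribution.cmod_char_le_1[OF rd] char_bind(2)[OF K] in auto)
    have term_int: "integrable M (\<lambda>\<omega>. (\<i> * complex_of_real t) ^ k / fact k * complex_of_real (?m \<omega> k))" for k
      by (intro integrable_mult_right integrable_of_real mom_int)
    have Ti: "integrable M (\<lambda>\<omega>. T n (?m \<omega>))"
      unfolding T_def by (intro Bochner_Integration.integrable_sum term_int)
    have term_eq: "(\<integral>\<omega>. (\<i> * complex_of_real t) ^ k / fact k * complex_of_real (?m \<omega> k) \<partial>M) =
        (\<i> * complex_of_real t) ^ k / fact k * complex_of_real (m k)" for k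
      unfolding integral_mult_right_zero integral_complex_of_real m_def eq ..
    have T: "(\<integral>\<omega>. T n (?m \<omega>) \<partial>M) = T n m"
      unfolding T_def by (subst Bochner_Integration.integral_sum[OF term_int]) (simp only: term_eq)
    have "cmod (char (M \<bind> K) t - T n m) = cmod (\<integral>\<omega>. char (K \<omega>) t - T n (?m \<omega>) \<partial>M)"
      by (simp add: char_bind(1)[OF K] Bochner_Integration.integral_diff[OF ci Ti] T)
    also have "\<dots> \<le> (\<integral>\<omega>. cmod (char (K \<omega>) t - T n (?m \<omega>)) \<partial>M)"
      by (rule integral_norm_bound)
    also have "\<dots> \<le> (\<integral>\<omega>. 2 * t ^ (2 * n) / fact (2 * n) * ?m \<omega> (2 * n) \<partial>M)"
      using ci Ti mom_int approx[OF rd K_int]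
      by (intro integral_mono integrable_norm Bochner_Integration.integrable_diff integrable_mult_right) auto
    also have "\<dots> = b n"
      unfolding integral_mult_right_zero b_def m_def eq ..
    finally show ?thesis .
  qed
  have "cmod (char \<mu> t - char (M \<bind> K) t) \<le> 2 * b n" for n
    using norm_triangle_ineq4[of "char \<mu> t - T n m" "char (M \<bind> K) t - T n m"] a1[of n] a2[of n] by simp
  moreover have "(\<lambda>n. 2 * b n) \<longlonglongrightarrow> 2 * (2 * 0)"
    using growth[of t] unfolding b_def m_def times_divide_eq_right[symmetric] mult.assoc
    by (intro tendsto_mult tendsto_const)
  ultimately have "cmod (char \<mu> t - char (M \<bind> K) t) \<le> 2 * (2 * 0)"
    by (intro LIMSEQ_le_const[of "\<lambda>n. 2 * b n"]) auto
  then show "char \<mu> t = char (M \<bind> K) t" by simp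
qed

text \<open>The factor \<open>(2 n)!\<close> of the normal moment cancels, leaving a term of the
  exponential series at \<open>t^2 * D^2 / 2\<close>.\<close>

lemma gaussian_growth_tendsto_0:
  fixes t D :: real
  shows "(\<lambda>n. t ^ (2 * n) / fact (2 * n) * (D ^ (2 * n) * normal_moment 1 (2 * n))) \<longlonglongrightarrow> 0"
proof -
  have nm: "normal_moment 1 (2 * n) = fact (2 * n) / (2 ^ n * fact n)" for n
    using normal_moment_even_eq[of 1 n] by simp
  have "t ^ (2 * n) / fact (2 * n) * (D ^ (2 * n) * normal_moment 1 (2 * n)) = inverse (fact n) * (t\<^sup>2 * D\<^sup>2 / 2) ^ n" for n
    unfolding nm power_mult[of t] power_mult[of D]
      power_mult_distrib power_divide
    by (simp add: field_simps)
  then show ?thesis using summable_LIMSEQ_zero[OF summable_exp[of "t\<^sup>2 * D\<^sup>2 / 2"]] by simp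
qed

theorem theorem1p1:
  fixes d :: nat and \<mu> :: "real measure"
    and P :: "'w measure" and M :: "'w \<Rightarrow> complex mat"
  assumes "d \<ge> 1"
    and "real_distribution \<mu>"
    and "limit_in_moments (phi d) (s_seq d) \<mu>"
    and "prob_space P"
    and "GUE_matrix d P M"
  shows "(\<mu> \<star> density lborel (normal_density 0 (sqrt (1 / (real d)\<^sup>2)))) = avg_eigenvalue_distr P M"
proof -
  note d = assms(1)
  interpret P: prob_space P by fact
  interpret \<mu>: real_distribution \<mu> by fact
  let ?A = "{..<d} \<times> {..<d}" and ?I = "gue_indices d"
  obtain \<xi> \<eta> where
    ind: "P.indep_vars (\<lambda>_. borel) (case_sum (\<lambda>(i, j). \<xi> i j) (\<lambda>(i, j). \<eta> i j)) ?I"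
    and diag: "\<And>i. i < d \<Longrightarrow> distributed P lborel (\<xi> i i) (normal_density 0 (sqrt (1 / real d)))"
    and offdiag: "\<And>i j. i < j \<Longrightarrow> j < d \<Longrightarrow> distributed P lborel (\<xi> i j) (normal_density 0 (sqrt (1 / (2 * real d))))"
      "\<And>i j. i < j \<Longrightarrow> j < d \<Longrightarrow> distributed P lborel (\<eta> i j) (normal_density 0 (sqrt (1 / (2 * real d))))"
    and M: "\<And>\<omega>. \<omega> \<in> space P \<Longrightarrow> M \<omega> = mat d d (\<lambda>(i, j).
           if i = j then complex_of_real (\<xi> i i \<omega>)
           else if i < j then complex_of_real (\<xi> i j \<omega>) + \<i> * complex_of_real (\<eta> i j \<omega>)
           else complex_of_real (\<xi> j i \<omega>) - \<i> * complex_of_real (\<eta> j i \<omega>))"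
    using assms(5) unfolding GUE_matrix_def gue_indices_def by blast
  define Z where "Z = case_sum (\<lambda>(i, j). \<xi> i j) (\<lambda>(i, j). \<eta> i j)"
  have G: "P.gaussian_family ?I (gue_sd d) Z"
    unfolding P.gaussian_family_def
  proof (intro conjI ballI)
    show "P.indep_vars (\<lambda>_. borel) Z ?I" using ind by (simp only: Z_def)
    fix \<alpha> assume "\<alpha> \<in> ?I"
    then show "0 < gue_sd d \<alpha>"
      and "distributed P lborel (Z \<alpha>) (normal_density 0 (gue_sd d \<alpha>))"
      using d diag offdiag by (auto simp: gue_indices_def Z_def order.order_iff_strict)
  qed simp
  let ?L = "P.linear_form ?I Z"
  define g where "g \<omega> = ?L (gue_trace_form d) \<omega>" for \<omega>
  define N where "N \<omega> x = ?L (traceless_form d x) \<omega>" for \<omega> x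
  have carrier: "M \<omega> \<in> carrier_mat d d" if "\<omega> \<in> space P" for \<omega>
    using M[OF that] by simp
  have entry: "M \<omega> $$ x = ?L (gue_coeff x) \<omega>" if "\<omega> \<in> space P" "x \<in> ?A" for \<omega> x
    using that M[OF that(1)] by (cases x) (auto simp: P.linear_form_gue_coeff Z_def)
  have herm: "M \<omega> $$ (j, i) = cnj (M \<omega> $$ (i, j))" if "\<omega> \<in> space P" "i < d" "j < d" for \<omega> i j
    using that M[OF that(1)] by auto

  define E where "E cs = (\<integral>\<omega>. (\<Prod>c\<leftarrow>cs. ?L c \<omega>) \<partial>P)" for cs
  have E_int: "integrable P (\<lambda>\<omega>. \<Prod>c\<leftarrow>cs. ?L c \<omega>)" for cs
    using P.integrable_mixed_moment[OF G, of "\<lambda>_. 0" cs] by (simp add: P.monomial_def)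
  have E_wick: "wick_functional UNIV (gue_cov d) E"
    using P.gaussian_wick[OF G] by (simp add: gue_cov_def[abs_def] E_def[abs_def])
  \<comment> \<open>The Gaussian moments of the traceless part of the given matrix; this is the Wick
    functional to which the limit theorem is applied.\<close>
  define W where "W w = E (map (traceless_form d) w)" for w
  define mom where "mom k = 1 / of_nat d * (\<Sum>a<d. path_sum d k a a W)" for k
  have W_wick: "wick_functional ?A (traceless_cov d) W"
  proof (rule wick_functional_cong)
    show "wick_functional ?A (\<lambda>x y. gue_cov d (traceless_form d x) (traceless_form d y)) W"
      using wick_functional_map[OF E_wick, of "traceless_form d"]
      by (simp add: wick_functional_def W_def[abs_def])
  qed (auto simp: gue_cov_traceless)
  have W_Nil: "W [] = 1" using W_wick by (simp add: wick_functional_def)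

  \<comment> \<open>\<open>limit_in_moments\<close> starts at \<open>k = 1\<close>; order 0 is
    supplied by the total mass of \<open>\<mu>\<close>.\<close>
  have \<mu>_int: "integrable \<mu> (\<lambda>t. t ^ k)" for k
    using assms(3) by (cases "k = 0") (auto simp: limit_in_moments_def)
  have \<mu>_mom: "complex_of_real (\<integral>t. t ^ k \<partial>\<mu>) = mom k" for k
  proof (cases "k = 0")
    case True
    then show ?thesis using d \<mu>.prob_space by (simp add: mom_def W_Nil)
  next
    case False
    then have "(\<lambda>n. phi d (s_seq d n ^ k)) \<longlonglongrightarrow> complex_of_real (\<integral>t. t ^ k \<partial>\<mu>)"
      using assms(3) by (simp add: limit_in_moments_def)
    then show ?thesis
      unfolding mom_def using phi_s_seq_power_tendsto[OF d W_wick] by (rule LIMSEQ_unique)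
  qed

  let ?s = "sqrt (1 / (real d)\<^sup>2)"
  let ?\<nu> = "density lborel (normal_density 0 ?s)"
  have s: "?s > 0" using d by simp
  note conv = convolution_moment[OF assms(2) normal_distr_moment(1)[OF s] \<mu>_int normal_distr_moment(2)[OF s]]
  have conv_mom: "complex_of_real (\<integral>t. t ^ k \<partial>(\<mu> \<star> ?\<nu>)) =
      (\<Sum>j\<le>k. of_nat (k choose j) * of_real (normal_moment ?s (k - j)) * mom j)" for k
    unfolding conv(3) normal_distr_moment(3)[OF s] by (simp add: \<mu>_mom)

  let ?emp = "\<lambda>\<omega>. empirical_eigenvalue_distr (M \<omega>)"
  have emp_mom: "complex_of_real (\<integral>t. t ^ k \<partial>?emp \<omega>) =
      1 / of_nat d * (\<Sum>a<d. path_sum d k a a (\<lambda>w. \<Prod>c\<leftarrow>map gue_coeff w. ?L c \<omega>))"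
    if "\<omega> \<in> space P" for \<omega> k
  proof -
    have word: "(\<Prod>x\<leftarrow>w. M \<omega> $$ x) = (\<Prod>c\<leftarrow>map gue_coeff w. ?L c \<omega>)" if "w \<in> lists ?A" for w
      using that entry[OF \<open>\<omega> \<in> space P\<close>] by (induction w) auto
    have "complex_of_real (\<integral>t. t ^ k \<partial>?emp \<omega>) =
        1 / of_nat d * (\<Sum>a<d. path_sum d k a a (\<lambda>w. \<Prod>x\<leftarrow>w. M \<omega> $$ x))"
      by (rule empirical_moment[OF carrier[OF that] d]) (rule herm[OF that])
    also have "\<dots> = 1 / of_nat d * (\<Sum>a<d. path_sum d k a a (\<lambda>w. \<Prod>c\<leftarrow>map gue_coeff w. ?L c \<omega>))"
      by (intro arg_cong[where f = "(*) _"] sum.cong refl path_sum_cong word) auto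
    finally show ?thesis .
  qed
  have emp_int: "integrable P (\<lambda>\<omega>. complex_of_real (\<integral>t. t ^ k \<partial>?emp \<omega>))" for k
  proof -
    have "integrable P (\<lambda>\<omega>. 1 / of_nat d * (\<Sum>a<d. path_sum d k a a (\<lambda>w. \<Prod>c\<leftarrow>map gue_coeff w. ?L c \<omega>)))"
      by (intro integrable_mult_right Bochner_Integration.integrable_sum integrable_path_sum E_int)
    then show ?thesis by (simp add: emp_mom cong: Bochner_Integration.integrable_cong)
  qed
  have emp_int_real: "integrable P (\<lambda>\<omega>. \<integral>t. t ^ k \<partial>?emp \<omega>)" for k
    using integrable_Re[OF emp_int[of k]] by simp
  have E_emp: "(\<integral>\<omega>. complex_of_real (\<integral>t. t ^ k \<partial>?emp \<omega>) \<partial>P) =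
      1 / of_nat d * (\<Sum>a<d. path_sum d k a a (\<lambda>w. E (map gue_coeff w)))" for k
  proof -
    have "(\<integral>\<omega>. complex_of_real (\<integral>t. t ^ k \<partial>?emp \<omega>) \<partial>P) =
        (\<integral>\<omega>. 1 / of_nat d * (\<Sum>a<d. path_sum d k a a (\<lambda>w. \<Prod>c\<leftarrow>map gue_coeff w. ?L c \<omega>)) \<partial>P)"
      by (intro Bochner_Integration.integral_cong refl) (simp add: emp_mom)
    then show ?thesis
      unfolding E_def integral_mult_right_zero
      by (subst (asm) Bochner_Integration.integral_sum)
         (simp_all only: integrable_path_sum[OF E_int] integral_path_sum[OF E_int])
  qed

  \<comment> \<open>The normalized trace is uncorrelated with every traceless entry and has variance
    \<open>1 / d^2\<close>, the variance of the normal law in the convolution.\<close>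
  have E_factor: "E (replicate l (gue_trace_form d) @ map (traceless_form d) w) = of_real (normal_moment ?s l) * W w"
    if "w \<in> lists ?A" for l w
    unfolding W_def
  proof (rule wick_functional_replicate[OF E_wick _ _ s])
    fix y assume "y \<in> set (map (traceless_form d) w)"
    then show "gue_cov d (gue_trace_form d) y = 0"
      using that by (auto simp: gue_cov_trace_traceless)
  next
    show "gue_cov d (gue_trace_form d) (gue_trace_form d) = of_real (?s\<^sup>2)"
      using gue_cov_trace_trace[OF d] by (simp add: power_divide)
  qed
  have E_emp': "(\<integral>\<omega>. complex_of_real (\<integral>t. t ^ k \<partial>?emp \<omega>) \<partial>P) =
      (\<Sum>j\<le>k. of_nat (k choose j) * of_real (normal_moment ?s (k - j)) * mom j)" for k
  proof -
    let ?F = "\<lambda>j w \<omega>. \<Prod>c\<leftarrow>replicate (k - j) (gue_trace_form d) @ map (traceless_form d) w. ?L c \<omega>"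
    have F: "?F j w \<omega> = g \<omega> ^ (k - j) * (\<Prod>x\<leftarrow>w. N \<omega> x)" for j w \<omega>
      by (simp add: g_def N_def prod_list_replicate o_def)
    have form: "?L (gue_coeff x) \<omega> = N \<omega> x + (if fst x = snd x then g \<omega> else 0)" for x \<omega>
      unfolding N_def g_def by (rule P.linear_form_shift)
    \<comment> \<open>The matrix is its traceless part \<open>N\<close> plus the scalar
      \<open>g\<close>. The binomial expansion obtained here is that of the moments of the
      convolution.\<close>
    have shift: "path_sum d k a a (\<lambda>w. \<Prod>c\<leftarrow>map gue_coeff w. ?L c \<omega>) =
        (\<Sum>j\<le>k. of_nat (k choose j) * path_sum d j a a (\<lambda>w. ?F j w \<omega>))" if "a < d" for a \<omega>
      unfolding F path_sum_scale using path_sum_shift[OF that, of k a "N \<omega>" "g \<omega>"]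
      by (simp add: mult.assoc o_def form)
    have "(\<integral>\<omega>. complex_of_real (\<integral>t. t ^ k \<partial>?emp \<omega>) \<partial>P) =
        (\<integral>\<omega>. 1 / of_nat d * (\<Sum>a<d. \<Sum>j\<le>k. of_nat (k choose j) * path_sum d j a a (\<lambda>w. ?F j w \<omega>)) \<partial>P)"
      by (intro Bochner_Integration.integral_cong refl, simp only: emp_mom,
          intro arg_cong[where f = "(*) _"] sum.cong refl shift) simp
    also have "\<dots> = 1 / of_nat d * (\<Sum>a<d. \<Sum>j\<le>k. of_nat (k choose j) *
        path_sum d j a a (\<lambda>w. E (replicate (k - j) (gue_trace_form d) @ map (traceless_form d) w)))"
    proof -
      have i: "integrable P (\<lambda>\<omega>. of_nat (k choose j) * path_sum d j a a (\<lambda>w. ?F j w \<omega>))" for a j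
        by (intro integrable_mult_right integrable_path_sum E_int)
      show ?thesis
        unfolding integral_mult_right_zero
        by (subst Bochner_Integration.integral_sum, intro Bochner_Integration.integrable_sum i,
            subst Bochner_Integration.integral_sum[OF i])
           (simp only: integral_mult_right_zero integral_path_sum[OF E_int] E_def)
    qed
    also have "\<dots> = 1 / of_nat d * (\<Sum>a<d. \<Sum>j\<le>k. of_nat (k choose j) *
        (of_real (normal_moment ?s (k - j)) * path_sum d j a a W))"
      unfolding path_sum_scale[symmetric]
      by (intro arg_cong[where f = "(*) _"] sum.cong refl path_sum_cong E_factor) auto
    also have "\<dots> = (\<Sum>j\<le>k. of_nat (k choose j) * of_real (normal_moment ?s (k - j)) * mom j)"
      unfolding mom_def sum_distrib_left by (subst sum.swap) (simp only: mult_ac)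
    finally show ?thesis .
  qed
  have moments_eq: "(\<integral>t. t ^ k \<partial>(\<mu> \<star> ?\<nu>)) = (\<integral>\<omega>. \<integral>t. t ^ k \<partial>?emp \<omega> \<partial>P)" for k
  proof -
    have "complex_of_real (\<integral>t. t ^ k \<partial>(\<mu> \<star> ?\<nu>)) = complex_of_real (\<integral>\<omega>. \<integral>t. t ^ k \<partial>?emp \<omega> \<partial>P)"
      using conv_mom[of k] E_emp'[of k] by (simp only: integral_complex_of_real)
    then show ?thesis by (simp only: of_real_eq_iff)
  qed

  \<comment> \<open>The moment identity is used from the convolution towards the GUE matrix: its
    entries have covariances 0 or \<open>1 / d\<close>, hence at most 1, and there are at most
    \<open>d ^ k\<close> paths.\<close>
  have bound: "\<bar>\<integral>t. t ^ k \<partial>(\<mu> \<star> ?\<nu>)\<bar> \<le> real d ^ k * normal_moment 1 k" for k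
  proof -
    have E_le: "norm (E (map gue_coeff w)) \<le> normal_moment 1 k" if "length w = k" "w \<in> lists ?A" for w
    proof -
      have "wick_functional ?A (\<lambda>x y. gue_cov d (gue_coeff x) (gue_coeff y)) (\<lambda>w. E (map gue_coeff w))"
        using wick_functional_map[OF E_wick, of gue_coeff] by (simp add: wick_functional_def)
      from norm_wick_functional_le[OF this _ that(2)] show ?thesis
        using d by (auto simp: gue_cov_coeff norm_divide that(1) split: prod.splits)
    qed
    have "\<bar>\<integral>t. t ^ k \<partial>(\<mu> \<star> ?\<nu>)\<bar> = norm (1 / of_nat d * (\<Sum>a<d. path_sum d k a a (\<lambda>w. E (map gue_coeff w))))"
      unfolding E_emp[symmetric] integral_complex_of_real moments_eq by simp
    also have "\<dots> \<le> 1 / real d * (\<Sum>a<d. real d ^ k * normal_moment 1 k)"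
      unfolding norm_mult norm_divide
      by (intro mult_mono sum_norm_le norm_path_sum_le E_le normal_moment_1_nonneg) auto
    also have "\<dots> = real d ^ k * normal_moment 1 k" using d by simp
    finally show ?thesis .
  qed

  have "\<mu> \<star> ?\<nu> = P \<bind> ?emp"
  proof (rule P.bind_eqI_moments[OF _ _ emp_int_real conv(1,2) moments_eq])
    show "?emp \<in> P \<rightarrow>\<^sub>M prob_algebra borel"
      by (rule empirical_measurable[OF d carrier]) (use emp_int_real in auto)
    show "integrable (?emp \<omega>) (\<lambda>t. t ^ k)" if "\<omega> \<in> space P" for \<omega> k
      by (rule integral_empirical(2)[OF carrier[OF that] d]) simp
    show "(\<lambda>n. t ^ (2 * n) / fact (2 * n) * (\<integral>t. t ^ (2 * n) \<partial>(\<mu> \<star> ?\<nu>))) \<longlonglongrightarrow> 0" for t :: real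
    proof (rule Lim_null_comparison[OF _ gaussian_growth_tendsto_0[of t "real d"]])
      show "\<forall>\<^sub>F n in sequentially. norm (t ^ (2 * n) / fact (2 * n) * (\<integral>t. t ^ (2 * n) \<partial>(\<mu> \<star> ?\<nu>))) \<le>
          t ^ (2 * n) / fact (2 * n) * (real d ^ (2 * n) * normal_moment 1 (2 * n))"
      proof (intro always_eventually allI)
        fix n
        let ?x = "\<integral>t. t ^ (2 * n) \<partial>(\<mu> \<star> ?\<nu>)"
        have "norm (t ^ (2 * n) / fact (2 * n) * ?x) = t ^ (2 * n) / fact (2 * n) * \<bar>?x\<bar>"
          by (simp add: abs_mult power_even_abs)
        also have "\<dots> \<le> t ^ (2 * n) / fact (2 * n) * (real d ^ (2 * n) * normal_moment 1 (2 * n))"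
          by (intro mult_left_mono bound) simp
        finally show "norm (t ^ (2 * n) / fact (2 * n) * ?x) \<le> \<dots>" .
      qed
    qed
  qed
  then show ?thesis by (simp only: avg_eigenvalue_distr_def)
qed

end
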